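(* Let $\varepsilon>0$ and let $n$ be sufficiently large depending only on $\varepsilon$. If $n \log n < m < n^{3/2-\varepsilon}$, then there is a graph on $n$ vertices which is $(n,m)$-universal and misses at least $\frac{\varepsilon n^3 \log n}{2^{12}m}$ edges (i.e. has at most $\binom{n}{2}-\frac{\varepsilon n^3 \log n}{2^{12}m}$ edges).
   Context: A graph is $(n,m)$-universal if it contains a copy (as a not necessarily induced subgraph) of every graph on $n$ vertices with $m$ edges. $\log$ is the natural logarithm. *)

theory Defs
  imports Complex_Main
begin

definition simple_graph :: "'a set \<Rightarrow> 'a set set \<Rightarrow> bool" where
  "simple_graph V E \<longleftrightarrow> finite V \<and> E \<subseteq> {e. e \<subseteq> V \<and> card e = 2}"

(* A copy is a not necessarily induced subgraph: an injection of the vertices mapping edges to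
   edges; non-edges of (W, F) may be mapped to edges of (V, E). *)
definition contains_copy :: "'a set \<Rightarrow> 'a set set \<Rightarrow> 'b set \<Rightarrow> 'b set set \<Rightarrow> bool" where
  "contains_copy V E W F \<longleftrightarrow>
     (\<exists>f. inj_on f W \<and> f ` W \<subseteq> V \<and> (\<forall>e\<in>F. f ` e \<in> E))"

(* HOL cannot quantify over types inside a formula, so the graphs (W, F) range over those with
   vertices in nat. This loses nothing, see universal_contains_copy below. *)
definition universal :: "nat \<Rightarrow> nat \<Rightarrow> 'a set \<Rightarrow> 'a set set \<Rightarrow> bool" where
  "universal n m V E \<longleftrightarrow>
     (\<forall>(W :: nat set) F. simple_graph W F \<and> card W = n \<and> card F = m \<longrightarrow> contains_copy V E W F)"

lemma universal_contains_copy: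
  fixes W :: "'b set"
  assumes univ: "universal n m V E"
    and H: "simple_graph W F" "card W = n" "card F = m"
  shows "contains_copy V E W F"
proof -
  have fin: "finite W" and F: "\<And>e. e \<in> F \<Longrightarrow> e \<subseteq> W \<and> card e = 2"
    using H(1) by (auto simp: simple_graph_def)
  obtain g :: "'b \<Rightarrow> nat" where g: "inj_on g W"
    using finite_imp_inj_to_nat_seg[OF fin] by blast
  have inj: "inj_on ((`) g) F"
    by (rule inj_onI) (meson F g inj_on_image_eq_iff)
  have "g ` e \<subseteq> g ` W \<and> card (g ` e) = 2" if "e \<in> F" for e
    using F[OF that] card_image[OF inj_on_subset[OF g, of e]] by (simp add: image_mono)
  then have "simple_graph (g ` W) ((`) g ` F)"
    unfolding simple_graph_def using fin by blast
  moreover have "card (g ` W) = n" "card ((`) g ` F) = m"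
    using H card_image[OF g] card_image[OF inj] by simp_all
  ultimately have "contains_copy V E (g ` W) ((`) g ` F)"
    using univ unfolding universal_def by blast
  then obtain f where f: "inj_on f (g ` W)" "f ` g ` W \<subseteq> V" "\<forall>e\<in>(`) g ` F. f ` e \<in> E"
    unfolding contains_copy_def by (elim exE conjE)
  have "inj_on (f \<circ> g) W" using comp_inj_on[OF g f(1)] .
  moreover have "(f \<circ> g) ` W \<subseteq> V" "\<forall>e\<in>F. (f \<circ> g) ` e \<in> E"
    using f(2,3) by (simp_all add: image_image)
  ultimately show ?thesis unfolding contains_copy_def by blast
qed

end

(* The host is the complement of a bipartite graph H between p pairs {2x, 2x+1} and q further
   vertices b, where b is H-adjacent to exactly one vertex of each pair, chosen by a set tau b.
   Given F, use vertices of low degree for the pairs, so that most vertices v of F have at most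
   k = O(eps log n) neighbours in the pairs and none has both vertices of a pair as neighbours.
   Each pair may be placed in two ways, encoded by a set sigma; v can then be placed on b iff
   sigma has a prescribed trace on the set Q v of pairs meeting the neighbourhood of v. Hence, for
   a random tau, each v fits on at most about q / 2^|Q v| of the b, and, for a random sigma, the
   total weight 2^|Q v| of the v fitting on a given b is of order n; the concentration comes from
   splitting half of the v into classes with pairwise disjoint Q v, which are independent within
   a class. Hall's theorem then fills all q vertices b, and the rest of F is placed arbitrarily. *)
theory Submission
  imports Defs "HOL-Library.FuncSet" "HOL-Library.Disjoint_Sets" "HOL-Real_Asymp.Real_Asymp"
begin

section \<open>Averaging, matchings and exponential moments\<close>

text \<open>Union bound in exponential-moment form. The weights are normalised so that bad event
  \<open>i\<close> forces \<open>w i \<omega> \<ge> 1\<close>; if some bad event occurred at every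
  \<open>\<omega>\<close>, the total would reach \<open>card \<Omega>\<close>.\<close>

lemma ex_all_less_one_of_sum_less_card:
  fixes w :: "'i \<Rightarrow> 'o \<Rightarrow> real"
  assumes "finite \<Omega>" "finite I"
    and nonneg: "\<And>i \<omega>. i \<in> I \<Longrightarrow> \<omega> \<in> \<Omega> \<Longrightarrow> 0 \<le> w i \<omega>"
    and less: "(\<Sum>i\<in>I. \<Sum>\<omega>\<in>\<Omega>. w i \<omega>) < real (card \<Omega>)"
  shows "\<exists>\<omega>\<in>\<Omega>. \<forall>i\<in>I. w i \<omega> < 1"
proof (rule ccontr)
  assume "\<not> ?thesis"
  then have bad: "\<exists>i\<in>I. 1 \<le> w i \<omega>" if "\<omega> \<in> \<Omega>" for \<omega>
    using that by (auto simp: not_less)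
  have "1 \<le> (\<Sum>i\<in>I. w i \<omega>)" if \<omega>: "\<omega> \<in> \<Omega>" for \<omega>
  proof -
    obtain i where i: "i \<in> I" "1 \<le> w i \<omega>" using bad[OF \<omega>] by blast
    have "w i \<omega> \<le> (\<Sum>i\<in>I. w i \<omega>)"
      by (rule member_le_sum) (use i nonneg \<omega> \<open>finite I\<close> in auto)
    then show ?thesis using i by linarith
  qed
  then have "(\<Sum>\<omega>\<in>\<Omega>. 1) \<le> (\<Sum>\<omega>\<in>\<Omega>. \<Sum>i\<in>I. w i \<omega>)"
    by (intro sum_mono) auto
  also have "\<dots> = (\<Sum>i\<in>I. \<Sum>\<omega>\<in>\<Omega>. w i \<omega>)" by (rule sum.swap)
  finally show False using less by simp
qed

section \<open>Hall's theorem and a weighted sufficient condition\<close>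

text \<open>Induction on \<open>card B\<close>. Either some nonempty proper subset \<open>X\<close>
  is tight, and \<open>X\<close> and \<open>B - X\<close> are matched separately, or every such
  subset has slack, and an arbitrary choice for one \<open>b\<close> can be extended.\<close>

lemma ex_injective_choice_of_Hall:
  assumes "finite B"
    and "\<And>b. b \<in> B \<Longrightarrow> finite (A b)"
    and "\<And>X. X \<subseteq> B \<Longrightarrow> card X \<le> card (\<Union>(A ` X))"
  shows "\<exists>g. inj_on g B \<and> (\<forall>b\<in>B. g b \<in> A b)"
  using assms
proof (induction "card B" arbitrary: B A rule: less_induct)
  case less
  note fin = less.prems(1) and finA = less.prems(2) and Hall = less.prems(3)
  show ?case
  proof (cases "B = {}")
    case False
    then obtain b where b: "b \<in> B" by blast
    have finU: "finite (\<Union>(A ` X))" if "X \<subseteq> B" for X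
      using that fin finA by (auto intro: finite_subset)
    show ?thesis
    proof (cases "\<exists>X. X \<noteq> {} \<and> X \<subset> B \<and> card (\<Union>(A ` X)) = card X")
      case True
      then obtain X where X: "X \<noteq> {}" "X \<subset> B" "card (\<Union>(A ` X)) = card X" by blast
      have finX: "finite X" using X fin finite_subset by blast
      have "card X < card B" using X fin by (simp add: psubset_card_mono)
      then obtain g1 where g1: "inj_on g1 X" "\<forall>x\<in>X. g1 x \<in> A x"
        using less.hyps[of X A] X finX finA Hall by blast
      \<comment> \<open>The tight set \<open>X\<close> uses up all of its options, so
        \<open>B - X\<close> has to be matched outside them. Hall's condition survives there: apply
        it to \<open>Y \<union> X\<close> and cancel the equality for \<open>X\<close>.\<close>
      define A' where "A' = (\<lambda>x. A x - \<Union>(A ` X))"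
      have "card Y \<le> card (\<Union>(A' ` Y))" if Y: "Y \<subseteq> B - X" for Y
      proof -
        have finY: "finite Y" using Y fin finite_subset by blast
        have "card Y + card X = card (Y \<union> X)"
          by (rule card_Un_disjoint[symmetric]) (use Y finX finY in auto)
        also have "\<dots> \<le> card (\<Union>(A ` (Y \<union> X)))" by (rule Hall) (use Y X in auto)
        also have "\<Union>(A ` (Y \<union> X)) = \<Union>(A' ` Y) \<union> \<Union>(A ` X)" by (auto simp: A'_def)
        also have "card \<dots> \<le> card (\<Union>(A' ` Y)) + card (\<Union>(A ` X))" by (rule card_Un_le)
        finally show ?thesis using X by simp
      qed
      moreover have "card (B - X) < card B" using X fin by (intro psubset_card_mono) auto
      ultimately obtain g2 where g2: "inj_on g2 (B - X)" "\<forall>x\<in>B - X. g2 x \<in> A' x"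
        using less.hyps[of "B - X" A'] fin finA by (auto simp: A'_def)
      define g where "g = (\<lambda>x. if x \<in> X then g1 x else g2 x)"
      have "g x \<in> A x" if "x \<in> B" for x using that g1 g2 by (auto simp: g_def A'_def)
      moreover have "inj_on g B"
      proof (rule inj_onI)
        fix x y assume xy: "x \<in> B" "y \<in> B" "g x = g y"
        have cross: False if "u \<in> X" "v \<in> B - X" "g1 u = g2 v" for u v
          using that g1 g2 unfolding A'_def by (metis DiffD2 UN_I)
        show "x = y"
          using xy cross[of x y] cross[of y x] g1(1) g2(1)
          by (auto simp: g_def inj_on_def split: if_splits)
      qed
      ultimately show ?thesis by blast
    next
      case False
      then have strict: "card X < card (\<Union>(A ` X))" if "X \<noteq> {}" "X \<subset> B" for X
        using that Hall[of X] by (metis le_neq_implies_less psubset_imp_subset)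
      have "A b \<noteq> {}" using Hall[of "{b}"] b by auto
      then obtain a where a: "a \<in> A b" by blast
      have "card X \<le> card (\<Union>((\<lambda>x. A x - {a}) ` X))" if X: "X \<subseteq> B - {b}" for X
      proof (cases "X = {}")
        case False
        \<comment> \<open>The slack of one absorbs the deletion of \<open>a\<close>.\<close>
        have "card X < card (\<Union>(A ` X))" using strict[OF False] X b by auto
        moreover have "\<Union>((\<lambda>x. A x - {a}) ` X) = \<Union>(A ` X) - {a}" by auto
        ultimately show ?thesis by (auto simp: card_Diff_singleton_if)
      qed simp
      moreover have "card (B - {b}) < card B" using b fin by (intro psubset_card_mono) auto
      ultimately obtain g where g: "inj_on g (B - {b})" "\<forall>x\<in>B - {b}. g x \<in> A x - {a}"
        using less.hyps[of "B - {b}" "\<lambda>x. A x - {a}"] fin finA by auto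
      have "inj_on (g(b := a)) B" using g by (auto simp: inj_on_def)
      moreover have "\<forall>x\<in>B. (g(b := a)) x \<in> A x" using g a by auto
      ultimately show ?thesis by blast
    qed
  qed simp
qed

text \<open>Double counting of weighted pairs: a set \<open>X\<close> of left vertices sends out
  weight at least \<open>\<alpha> * card X\<close>, while each neighbour absorbs at most
  \<open>\<alpha>\<close>, so there are at least \<open>card X\<close> neighbours and Hall's theorem
  applies.\<close>

lemma ex_injective_choice_of_weights:
  fixes w :: "'v \<Rightarrow> real"
  assumes fin: "finite B" "finite L" and "\<alpha> > 0"
    and w: "\<And>v. v \<in> L \<Longrightarrow> 0 \<le> w v"
    and left: "\<And>b. b \<in> B \<Longrightarrow> \<alpha> \<le> (\<Sum>v | v \<in> L \<and> r b v. w v)"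
    and right: "\<And>v. v \<in> L \<Longrightarrow> w v * real (card {b \<in> B. r b v}) \<le> \<alpha>"
  shows "\<exists>g. inj_on g B \<and> (\<forall>b\<in>B. g b \<in> L \<and> r b (g b))"
proof -
  define A where "A = (\<lambda>b. {v \<in> L. r b v})"
  have "card X \<le> card (\<Union>(A ` X))" if X: "X \<subseteq> B" for X
  proof -
    have finX: "finite X" using X fin finite_subset by blast
    let ?N = "\<Union>(A ` X)"
    have N: "?N \<subseteq> L" "finite ?N" using fin by (auto simp: A_def intro: finite_subset)
    have "real (card X) * \<alpha> = (\<Sum>b\<in>X. \<alpha>)" by simp
    also have "\<dots> \<le> (\<Sum>b\<in>X. \<Sum>v | v \<in> L \<and> r b v. w v)" using left X by (intro sum_mono) auto
    also have "\<dots> = (\<Sum>b\<in>X. \<Sum>v | v \<in> ?N \<and> r b v. w v)"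
      by (intro sum.cong refl) (auto simp: A_def)
    also have "\<dots> = (\<Sum>v\<in>?N. \<Sum>b | b \<in> X \<and> r b v. w v)"
      by (rule sum.swap_restrict) (use finX N in auto)
    also have "\<dots> \<le> (\<Sum>v\<in>?N. \<alpha>)"
    proof (rule sum_mono)
      fix v assume v: "v \<in> ?N"
      have "card {b \<in> X. r b v} \<le> card {b \<in> B. r b v}" by (rule card_mono) (use fin X in auto)
      then have "w v * real (card {b \<in> X. r b v}) \<le> w v * real (card {b \<in> B. r b v})"
        using w v N by (intro mult_left_mono) auto
      then show "(\<Sum>b | b \<in> X \<and> r b v. w v) \<le> \<alpha>"
        using right[of v] v N by (simp add: mult.commute) force
    qed
    finally have "real (card X) * \<alpha> \<le> real (card ?N) * \<alpha>" by simp
    then show ?thesis using \<open>\<alpha> > 0\<close> by simp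
  qed
  moreover have "finite (A b)" if "b \<in> B" for b using fin by (simp add: A_def)
  ultimately obtain g where "inj_on g B" "\<forall>b\<in>B. g b \<in> A b"
    using ex_injective_choice_of_Hall[OF fin(1), of A] by blast
  then show ?thesis by (auto simp: A_def)
qed

section \<open>Independence of traces of a uniformly random subset\<close>

text \<open>For a uniformly random subset of \<open>P\<close>, the parts inside and outside
  \<open>Q\<close> are independent.\<close>

lemma sum_Pow_split:
  fixes h G :: "'a set \<Rightarrow> real"
  assumes "finite P" "Q \<subseteq> P"
  shows "(\<Sum>\<sigma>\<in>Pow P. h (\<sigma> \<inter> Q) * G (\<sigma> - Q)) = sum h (Pow Q) * sum G (Pow (P - Q))"
proof -
  have "(\<Sum>\<sigma>\<in>Pow P. h (\<sigma> \<inter> Q) * G (\<sigma> - Q))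
      = (\<Sum>(\<rho>, \<pi>)\<in>Pow Q \<times> Pow (P - Q). h \<rho> * G \<pi>)"
    by (rule sum.reindex_bij_witness[of _ "\<lambda>(\<rho>, \<pi>). \<rho> \<union> \<pi>" "\<lambda>\<sigma>. (\<sigma> \<inter> Q, \<sigma> - Q)"])
      (use assms in \<open>auto simp: Int_absorb2 Un_Diff Int_Un_distrib2\<close>)
  then show ?thesis by (simp add: sum_product sum.cartesian_product)
qed

text \<open>Events on disjoint sets \<open>Q v\<close> are independent, and each has probability 1 /
  2^|Q v|. The sign of \<open>h\<close> is left open so that the formula serves both tails: a
  negative \<open>h\<close> gives the moment for an upper tail, a positive one that for a lower
  tail.\<close>

lemma sum_Pow_prod_disjoint:
  fixes h :: "'v \<Rightarrow> real"
  assumes "finite C" "finite P" "disjoint_family_on Q C"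
    and "\<And>v. v \<in> C \<Longrightarrow> Q v \<subseteq> P" "\<And>v. v \<in> C \<Longrightarrow> R v \<subseteq> Q v"
  shows "(\<Sum>\<sigma>\<in>Pow P. \<Prod>v\<in>C. 1 - h v * of_bool (\<sigma> \<inter> Q v = R v))
    = 2 ^ card P * (\<Prod>v\<in>C. 1 - h v / 2 ^ card (Q v))"
  using assms
proof (induction C arbitrary: P rule: finite_induct)
  case empty
  then show ?case by (simp add: card_Pow)
next
  case (insert v C)
  have QP: "Q v \<subseteq> P" and fin: "finite P" "finite (Q v)"
    using insert.prems by (auto intro: finite_subset)
  have disj: "Q v \<inter> Q u = {}" "u \<noteq> v" if "u \<in> C" for u
    using insert.prems(2) insert.hyps that by (auto simp: disjoint_family_on_def)
  \<comment> \<open>As \<open>Q u\<close> avoids \<open>Q v\<close>, the other factors depend only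
    on \<open>\<sigma> - Q v\<close>; this is the form that \<open>sum_Pow_split\<close>
    needs.\<close>
  have "(\<Sum>\<sigma>\<in>Pow P. \<Prod>u\<in>insert v C. 1 - h u * of_bool (\<sigma> \<inter> Q u = R u))
      = (\<Sum>\<sigma>\<in>Pow P. (1 - h v * of_bool (\<sigma> \<inter> Q v = R v)) *
          (\<Prod>u\<in>C. 1 - h u * of_bool ((\<sigma> - Q v) \<inter> Q u = R u)))"
  proof (intro sum.cong refl)
    fix \<sigma>
    have "(\<sigma> - Q v) \<inter> Q u = \<sigma> \<inter> Q u" if "u \<in> C" for u using disj[OF that] by blast
    then show "(\<Prod>u\<in>insert v C. 1 - h u * of_bool (\<sigma> \<inter> Q u = R u))
      = (1 - h v * of_bool (\<sigma> \<inter> Q v = R v)) *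
          (\<Prod>u\<in>C. 1 - h u * of_bool ((\<sigma> - Q v) \<inter> Q u = R u))"
      using insert.hyps by (simp cong: prod.cong)
  qed
  also have "\<dots> = (\<Sum>\<rho>\<in>Pow (Q v). 1 - h v * of_bool (\<rho> = R v)) *
      (\<Sum>\<pi>\<in>Pow (P - Q v). \<Prod>u\<in>C. 1 - h u * of_bool (\<pi> \<inter> Q u = R u))"
    by (rule sum_Pow_split[OF fin(1) QP, of "\<lambda>\<rho>. 1 - h v * of_bool (\<rho> = R v)"])
  also have "(\<Sum>\<pi>\<in>Pow (P - Q v). \<Prod>u\<in>C. 1 - h u * of_bool (\<pi> \<inter> Q u = R u))
      = 2 ^ card (P - Q v) * (\<Prod>u\<in>C. 1 - h u / 2 ^ card (Q u))"
  proof (rule insert.IH)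
    show "disjoint_family_on Q C"
      using insert.prems(2) by (rule disjoint_family_on_mono[rotated]) auto
    show "Q u \<subseteq> P - Q v" if "u \<in> C" for u using insert.prems(3)[of u] disj[OF that] that by blast
  qed (use insert.prems fin in auto)
  also have "(\<Sum>\<rho>\<in>Pow (Q v). 1 - h v * of_bool (\<rho> = R v)) = 2 ^ card (Q v) - h v"
  proof -
    have "R v \<in> Pow (Q v)" using insert.prems by auto
    moreover have "(\<Sum>\<rho>\<in>Pow (Q v). h v * of_bool (\<rho> = R v)) = (\<Sum>\<rho>\<in>Pow (Q v). if \<rho> = R v then h v else 0)"
      by (intro sum.cong) auto
    ultimately show ?thesis using fin by (simp add: sum_subtractf card_Pow)
  qed
  also have "\<dots> = 2 ^ card (Q v) * (1 - h v / 2 ^ card (Q v))" by (simp add: field_simps)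
  also have "(2::real) ^ card (Q v) * (1 - h v / 2 ^ card (Q v)) *
      (2 ^ card (P - Q v) * (\<Prod>u\<in>C. 1 - h u / 2 ^ card (Q u)))
    = 2 ^ (card (Q v) + card (P - Q v)) * (\<Prod>u\<in>insert v C. 1 - h u / 2 ^ card (Q u))"
    using insert.hyps by (simp add: power_add)
  also have "card (Q v) + card (P - Q v) = card P"
    using fin QP by (simp add: card_Diff_subset card_mono)
  finally show ?case .
qed

section \<open>Random set families\<close>

text \<open>A pair is encoded by a word of length \<open>k\<close> over an alphabet of 2 (|P| + 1)
  letters: an element of \<open>P\<close>, or \<open>None\<close>, together with a flag telling
  whether the element lies in \<open>R\<close>.\<close>

lemma card_pairs_small_subsets_le:
  fixes P :: "'a set"
  assumes "finite P"
  shows "card (SIGMA Q:{Q. Q \<subseteq> P \<and> card Q \<le> k}. Pow Q) \<le> (2 * (card P + 1)) ^ k"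
    and "finite (SIGMA Q:{Q. Q \<subseteq> P \<and> card Q \<le> k}. Pow Q)"
proof -
  let ?I = "SIGMA Q:{Q. Q \<subseteq> P \<and> card Q \<le> k}. Pow Q"
  define U where "U = (UNIV :: bool set) \<times> insert None (Some ` P)"
  define dec :: "(bool \<times> 'a option) list \<Rightarrow> 'a set \<times> 'a set" where
    "dec = (\<lambda>xs. ({x. \<exists>i. (i, Some x) \<in> set xs}, {x. (True, Some x) \<in> set xs}))"
  have finU: "finite U" using assms by (simp add: U_def)
  have cardU: "card U = 2 * (card P + 1)"
    using assms by (simp add: U_def card_cartesian_product card_image)
  have "?I \<subseteq> dec ` {xs. set xs \<subseteq> U \<and> length xs = k}"
  proof
    fix z assume "z \<in> ?I"
    then obtain Q R where z: "z = (Q, R)" and Q: "Q \<subseteq> P" "card Q \<le> k" and R: "R \<subseteq> Q" by auto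
    have "finite Q" using Q assms finite_subset by blast
    then obtain qs where qs: "set qs = Q" "distinct qs" using finite_distinct_list by blast
    \<comment> \<open>\<open>dec\<close> ignores \<open>(False, None)\<close>, which therefore pads
      the word to length exactly \<open>k\<close>.\<close>
    define xs where "xs = map (\<lambda>x. (x \<in> R, Some x)) qs @ replicate (k - length qs) (False, None)"
    have "length qs \<le> k" using qs Q distinct_card[of qs] by simp
    then have "length xs = k" by (simp add: xs_def)
    moreover have "set xs \<subseteq> U" using qs Q by (auto simp: xs_def U_def)
    moreover have "dec xs = z" using qs R by (auto simp: xs_def dec_def z)
    ultimately show "z \<in> dec ` {xs. set xs \<subseteq> U \<and> length xs = k}" by blast
  qed
  then show "card ?I \<le> (2 * (card P + 1)) ^ k" "finite ?I"
    using card_mono[OF _ \<open>?I \<subseteq> _\<close>] card_image_le[of "{xs. set xs \<subseteq> U \<and> length xs = k}" dec]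
      finite_lists_length_eq[OF finU, of k] card_lists_length_eq[OF finU, of k] cardU
    by (auto intro: finite_subset order_trans)
qed

text \<open>Chernoff bound for the upper tail. For uniformly random \<tau> the number of
  \<open>b\<close> with trace \<open>R\<close> on \<open>Q\<close> is binomial with mean |B| /
  2^|Q|; it exceeds four times the mean with probability at most exp (-|B| / 2^k), and the union
  bound runs over all pairs (Q, R).\<close>

lemma ex_balanced_family:
  fixes P :: "'a set" and B :: "'b set"
  assumes fin: "finite P" "finite B"
    and small: "(2 * (real (card P) + 1)) ^ k * exp (- real (card B) / 2 ^ k) < 1"
  shows "\<exists>\<tau>. \<forall>Q R. Q \<subseteq> P \<longrightarrow> card Q \<le> k \<longrightarrow> R \<subseteq> Q \<longrightarrow>
     2 ^ card Q * real (card {b \<in> B. \<tau> b \<inter> Q = R}) \<le> 4 * real (card B)"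
proof -
  let ?I = "SIGMA Q:{Q. Q \<subseteq> P \<and> card Q \<le> k}. Pow Q"
  let ?\<Omega> = "B \<rightarrow>\<^sub>E Pow P"
  define t where "t = (\<lambda>Q :: 'a set. 4 * real (card B) / 2 ^ card Q)"
  \<comment> \<open>\<open>w (Q, R) \<tau> < 1\<close> says exactly that the count stays below the
    threshold \<open>t Q\<close>.\<close>
  define w :: "'a set \<times> 'a set \<Rightarrow> ('b \<Rightarrow> 'a set) \<Rightarrow> real" where
    "w = (\<lambda>(Q, R) \<tau>. exp (real (card {b \<in> B. \<tau> b \<inter> Q = R}) - t Q))"
  have card\<Omega>: "real (card ?\<Omega>) = (2 ^ card P) ^ card B"
    using fin by (simp add: card_PiE card_Pow)
  have bound: "(\<Sum>\<tau>\<in>?\<Omega>. w (Q, R) \<tau>) \<le> real (card ?\<Omega>) * exp (- real (card B) / 2 ^ k)"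
    if QR: "Q \<subseteq> P" "card Q \<le> k" "R \<subseteq> Q" for Q R
  proof -
    \<comment> \<open>The exponential of an indicator is rewritten as an affine function of it, to
      fit \<open>sum_Pow_prod_disjoint\<close> with \<open>h = 1 - exp 1\<close>.\<close>
    have "(\<Sum>\<tau>\<in>?\<Omega>. exp (real (card {b \<in> B. \<tau> b \<inter> Q = R})))
        = (\<Sum>\<tau>\<in>?\<Omega>. \<Prod>b\<in>B. 1 - (1 - exp 1) * of_bool (\<tau> b \<inter> Q = R))"
    proof (intro sum.cong refl)
      fix \<tau>
      have "(\<Prod>b\<in>B. 1 - (1 - exp 1) * of_bool (\<tau> b \<inter> Q = R))
          = (\<Prod>b\<in>B. exp (of_bool (\<tau> b \<inter> Q = R)) :: real)"
        by (intro prod.cong) auto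
      also have "\<dots> = exp (\<Sum>b\<in>B. of_bool (\<tau> b \<inter> Q = R))"
        by (rule exp_sum[symmetric, OF fin(2)])
      also have "(\<Sum>b\<in>B. of_bool (\<tau> b \<inter> Q = R)) = real (card {b \<in> B. \<tau> b \<inter> Q = R})"
        using fin by (simp add: Int_def)
      finally show "exp (real (card {b \<in> B. \<tau> b \<inter> Q = R}))
        = (\<Prod>b\<in>B. 1 - (1 - exp 1) * of_bool (\<tau> b \<inter> Q = R))" by simp
    qed
    \<comment> \<open>The sets \<open>\<tau> b\<close> are independent, so the sum factors over
      \<open>B\<close>; each factor is the case of a single event.\<close>
    also have "\<dots> = (\<Prod>b\<in>B. \<Sum>T\<in>Pow P. 1 - (1 - exp 1) * of_bool (T \<inter> Q = R))"
      by (subst prod_sum_PiE) (use fin in auto)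
    also have "(\<Sum>T\<in>Pow P. 1 - (1 - exp 1) * of_bool (T \<inter> Q = R))
        = 2 ^ card P * (1 - (1 - exp 1) / 2 ^ card Q :: real)"
      using sum_Pow_prod_disjoint[of "{()}" P "\<lambda>_. Q" "\<lambda>_. R" "\<lambda>_. 1 - exp 1"] fin QR
      by (simp add: disjoint_family_on_def)
    finally have eq: "(\<Sum>\<tau>\<in>?\<Omega>. exp (real (card {b \<in> B. \<tau> b \<inter> Q = R})))
        = real (card ?\<Omega>) * (1 - (1 - exp 1) / 2 ^ card Q) ^ card B"
      unfolding card\<Omega> by (simp add: power_mult_distrib)
    have "1 - (1 - exp 1) / 2 ^ card Q = 1 + (exp 1 - 1) / (2::real) ^ card Q"
      by (simp add: field_simps)
    \<comment> \<open>The 2 comes from \<open>exp 1 \<le> 3\<close>. The moment is thus at most the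
      exponential of twice the mean, which is half of \<open>t Q\<close>.\<close>
    also have "\<dots> \<le> 1 + 2 / 2 ^ card Q" using exp_le by (intro add_left_mono divide_right_mono) auto
    also have "\<dots> \<le> exp (2 / 2 ^ card Q)" by (rule exp_ge_add_one_self)
    finally have "(1 - (1 - exp 1) / 2 ^ card Q) ^ card B \<le> exp (2 / 2 ^ card Q :: real) ^ card B"
    proof (rule power_mono)
      have "(1::real) - exp 1 \<le> 0" using exp_ge_add_one_self[of "1::real"] by linarith
      then have "(1 - exp 1) / (2::real) ^ card Q \<le> 0" by (intro divide_nonpos_pos) auto
      then show "0 \<le> 1 - (1 - exp 1) / (2::real) ^ card Q" by linarith
    qed
    also have "\<dots> = exp (t Q / 2)" 
      unfolding exp_of_nat_mult[symmetric] by (simp add: t_def)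
    finally have "(\<Sum>\<tau>\<in>?\<Omega>. exp (real (card {b \<in> B. \<tau> b \<inter> Q = R}))) \<le> real (card ?\<Omega>) * exp (t Q / 2)"
      unfolding eq by (intro mult_left_mono) auto
    then have "(\<Sum>\<tau>\<in>?\<Omega>. exp (real (card {b \<in> B. \<tau> b \<inter> Q = R}))) * exp (- t Q)
        \<le> real (card ?\<Omega>) * exp (t Q / 2) * exp (- t Q)"
      by (rule mult_right_mono) simp
    also have "(\<Sum>\<tau>\<in>?\<Omega>. exp (real (card {b \<in> B. \<tau> b \<inter> Q = R}))) * exp (- t Q)
        = (\<Sum>\<tau>\<in>?\<Omega>. w (Q, R) \<tau>)"
      unfolding sum_distrib_right w_def exp_add[symmetric] by simp
    also have "real (card ?\<Omega>) * exp (t Q / 2) * exp (- t Q) = real (card ?\<Omega>) * exp (- (t Q / 2))"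
      unfolding mult.assoc exp_add[symmetric] by simp
    also have "\<dots> \<le> real (card ?\<Omega>) * exp (- real (card B) / 2 ^ k)"
    proof -
      have "real (card B) / 2 ^ k \<le> real (card B) / 2 ^ card Q"
        using QR by (intro divide_left_mono) (auto intro: power_increasing)
      also have "\<dots> \<le> t Q / 2" by (simp add: t_def divide_right_mono)
      finally show ?thesis by (intro mult_left_mono) auto
    qed
    finally show ?thesis .
  qed
  have "(\<Sum>i\<in>?I. \<Sum>\<tau>\<in>?\<Omega>. w i \<tau>) \<le> (\<Sum>i\<in>?I. real (card ?\<Omega>) * exp (- real (card B) / 2 ^ k))"
    using bound by (intro sum_mono) auto
  also have "\<dots> = real (card ?\<Omega>) * (real (card ?I) * exp (- real (card B) / 2 ^ k))" by simp
  also have "\<dots> \<le> real (card ?\<Omega>) * ((2 * (real (card P) + 1)) ^ k * exp (- real (card B) / 2 ^ k))"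
  proof (intro mult_left_mono mult_right_mono)
    have "real (card ?I) \<le> real ((2 * (card P + 1)) ^ k)"
      using card_pairs_small_subsets_le(1)[OF fin(1)] by (simp only: of_nat_le_iff)
    then show "real (card ?I) \<le> (2 * (real (card P) + 1)) ^ k" by (simp add: algebra_simps)
  qed auto
  also have "\<dots> < real (card ?\<Omega>) * 1"
    by (rule mult_strict_left_mono[OF small]) (simp only: card\<Omega> zero_less_power zero_less_numeral)
  finally have less: "(\<Sum>i\<in>?I. \<Sum>\<tau>\<in>?\<Omega>. w i \<tau>) < real (card ?\<Omega>)"
    by (simp only: mult_1_right)
  have "\<exists>\<tau>\<in>?\<Omega>. \<forall>i\<in>?I. w i \<tau> < 1"
    by (rule ex_all_less_one_of_sum_less_card[OF _ card_pairs_small_subsets_le(2)[OF fin(1)] _ less])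
      (use fin in \<open>auto simp: w_def intro: finite_PiE\<close>)
  then obtain \<tau> where \<tau>: "\<forall>i\<in>?I. w i \<tau> < 1" by (elim bexE)
  have "2 ^ card Q * real (card {b \<in> B. \<tau> b \<inter> Q = R}) \<le> 4 * real (card B)"
    if QR: "Q \<subseteq> P" "card Q \<le> k" "R \<subseteq> Q" for Q R
  proof -
    have "w (Q, R) \<tau> < 1" by (rule \<tau>[THEN bspec]) (use QR in simp)
    then have "real (card {b \<in> B. \<tau> b \<inter> Q = R}) < t Q" by (simp add: w_def)
    then show ?thesis by (simp add: t_def field_simps)
  qed
  then show ?thesis by (intro exI[of _ \<tau>] allI impI)
qed

text \<open>Chernoff bound for the lower tail. For random \<sigma>, a vertex \<open>v\<close> of
  \<open>C\<close> contributes 2^|Q v| with probability 1 / 2^|Q v|, so a class has expected weight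
  \<open>s\<close>; disjointness gives independence within a class, and the union bound runs over
  \<open>b\<close> and \<open>C\<close>.\<close>

lemma ex_subset_meeting_patterns:
  fixes P :: "'a set" and B :: "'b set" and \<C> :: "'v set set"
  assumes fin: "finite P" "finite B" "finite \<C>"
    and C: "\<And>C. C \<in> \<C> \<Longrightarrow> finite C \<and> card C = s \<and> disjoint_family_on Q C"
    and Q: "\<And>v. v \<in> \<Union>\<C> \<Longrightarrow> Q v \<subseteq> P \<and> card (Q v) \<le> k"
    and R: "\<And>b v. R b v \<subseteq> Q v"
    and small: "real (card B) * real (card \<C>) * exp (- (real s / 2 ^ k / 16)) < 1"
  shows "\<exists>\<sigma>\<subseteq>P. \<forall>b\<in>B. \<forall>C\<in>\<C>. real s / 2 \<le> (\<Sum>v | v \<in> C \<and> \<sigma> \<inter> Q v = R b v. 2 ^ card (Q v))"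
proof -
  \<comment> \<open>The weights scaled into [0, 1/4]. Each \<open>a v\<close> times its probability
    is 1 / (4 * 2^k), whatever the size of \<open>Q v\<close>.\<close>
  define a :: "'v \<Rightarrow> real" where "a = (\<lambda>v. 2 ^ card (Q v) / 2 ^ k / 4)"
  define x :: real where "x = real s / 2 ^ k"
  \<comment> \<open>The product has mean at most exp (-x/4), but is at least exp (-3x/16) if the
    weight falls below s/2. After normalisation the failure probability is at most exp
    (-x/16).\<close>
  define w :: "'b \<times> 'v set \<Rightarrow> 'a set \<Rightarrow> real" where
    "w = (\<lambda>(b, C) \<sigma>. (\<Prod>v\<in>C. 1 - a v * of_bool (\<sigma> \<inter> Q v = R b v)) * exp (3 / 16 * x))"
  have a: "0 \<le> a v \<and> a v \<le> 1 / 4" if "v \<in> \<Union>\<C>" for v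
  proof -
    have "(2::real) ^ card (Q v) \<le> 2 ^ k" using Q[OF that] by (intro power_increasing) auto
    then show ?thesis by (simp add: a_def)
  qed
  have pos: "0 \<le> w i \<sigma>" if i: "i \<in> B \<times> \<C>" for i \<sigma>
  proof -
    have "0 \<le> 1 - a v * of_bool (\<sigma> \<inter> Q v = R (fst i) v)" if v: "v \<in> snd i" for v
    proof -
      have "v \<in> \<Union>\<C>" using i v by auto
      then have "a v \<le> 1" using a[of v] by linarith
      then show ?thesis by simp
    qed
    then show ?thesis unfolding w_def
      by (simp add: case_prod_unfold prod_nonneg)
  qed
  have bound: "(\<Sum>\<sigma>\<in>Pow P. w (b, C) \<sigma>) \<le> real (card (Pow P)) * exp (- (x / 16))"
    if "b \<in> B" "C \<in> \<C>" for b C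
  proof -
    have "(\<Sum>\<sigma>\<in>Pow P. \<Prod>v\<in>C. 1 - a v * of_bool (\<sigma> \<inter> Q v = R b v))
        = 2 ^ card P * (\<Prod>v\<in>C. 1 - a v / 2 ^ card (Q v))"
      using C[OF that(2)] Q R that fin by (intro sum_Pow_prod_disjoint) auto
    also have "(\<Prod>v\<in>C. 1 - a v / 2 ^ card (Q v)) = (1 - 1 / 2 ^ k / 4) ^ s"
      using C[OF that(2)] by (simp add: a_def)
    also have "(1 - 1 / 2 ^ k / 4) ^ s \<le> exp (- (1 / 2 ^ k / 4) :: real) ^ s"
    proof (rule power_mono)
      show "1 - 1 / 2 ^ k / 4 \<le> exp (- (1 / 2 ^ k / 4) :: real)"
        using exp_ge_add_one_self[of "- (1 / 2 ^ k / 4) :: real"] by simp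
      have "1 \<le> (2::real) ^ k" by simp
      then have "1 \<le> 4 * (2::real) ^ k" by linarith
      then show "0 \<le> 1 - 1 / (2::real) ^ k / 4" by (simp add: field_simps)
    qed
    also have "exp (- (1 / 2 ^ k / 4) :: real) ^ s = exp (- (x / 4))"
      unfolding exp_of_nat_mult[symmetric] by (simp add: x_def)
    finally have "(\<Sum>\<sigma>\<in>Pow P. w (b, C) \<sigma>) \<le> 2 ^ card P * exp (- (x / 4)) * exp (3 / 16 * x)"
      by (simp add: w_def flip: sum_distrib_right)
    also have "\<dots> = 2 ^ card P * exp (- (x / 16))" by (simp add: mult.assoc flip: exp_add)
    finally show ?thesis using fin by (simp add: card_Pow)
  qed
  have "(\<Sum>i\<in>B \<times> \<C>. \<Sum>\<sigma>\<in>Pow P. w i \<sigma>) \<le> (\<Sum>i\<in>B \<times> \<C>. real (card (Pow P)) * exp (- (x / 16)))"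
    using bound by (intro sum_mono) auto
  also have "\<dots> = real (card (Pow P)) * (real (card B) * real (card \<C>) * exp (- (x / 16)))"
    by (simp add: card_cartesian_product)
  also have "\<dots> < real (card (Pow P)) * 1"
    using small fin by (intro mult_strict_left_mono) (auto simp: x_def card_Pow)
  finally have less: "(\<Sum>i\<in>B \<times> \<C>. \<Sum>\<sigma>\<in>Pow P. w i \<sigma>) < real (card (Pow P))" by simp
  have "\<exists>\<sigma>\<in>Pow P. \<forall>i\<in>B \<times> \<C>. w i \<sigma> < 1"
    by (rule ex_all_less_one_of_sum_less_card[OF _ _ pos less]) (use fin in auto)
  then obtain \<sigma> where \<sigma>: "\<sigma> \<subseteq> P" "\<And>i. i \<in> B \<times> \<C> \<Longrightarrow> w i \<sigma> < 1" by blast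
  have "real s / 2 \<le> (\<Sum>v | v \<in> C \<and> \<sigma> \<inter> Q v = R b v. 2 ^ card (Q v))" (is "_ \<le> ?W")
    if bC: "b \<in> B" "C \<in> \<C>" for b C
  proof (rule ccontr)
    assume "\<not> real s / 2 \<le> ?W"
    then have W: "?W < real s / 2" by simp
    have finC: "finite C" using C bC by blast
    have "(\<Sum>v\<in>C. a v * of_bool (\<sigma> \<inter> Q v = R b v)) = (\<Sum>v | v \<in> C \<and> \<sigma> \<inter> Q v = R b v. a v)"
      using finC by (simp add: sum.inter_filter[symmetric] of_bool_def if_distrib cong: if_cong)
    also have "\<dots> = ?W / 2 ^ k / 4" by (simp add: a_def sum_divide_distrib)
    also have "\<dots> \<le> x / 8"
      using W by (simp add: x_def field_simps)
    finally have sum_le: "(\<Sum>v\<in>C. a v * of_bool (\<sigma> \<inter> Q v = R b v)) \<le> x / 8" .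
    \<comment> \<open>3/16 is 3/2 times the bound 1/8 just obtained; the factor 3/2 is the price of
      replacing 1 - y by an exponential.\<close>
    have "exp (- (3 / 16 * x)) \<le> exp (\<Sum>v\<in>C. - (3 / 2) * (a v * of_bool (\<sigma> \<inter> Q v = R b v)))"
      using sum_le unfolding sum_distrib_left[symmetric] by simp
    also have "\<dots> = (\<Prod>v\<in>C. exp (- (3 / 2) * (a v * of_bool (\<sigma> \<inter> Q v = R b v))))"
      using finC by (rule exp_sum)
    also have "\<dots> \<le> (\<Prod>v\<in>C. 1 - a v * of_bool (\<sigma> \<inter> Q v = R b v))"
    proof (rule prod_mono)
      fix v assume "v \<in> C"
      \<comment> \<open>Near 0, ln (1 - y) \<ge> -y - 2y^2, and y \<le> 1/4 turns 2y^2 into at most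
        y/2.\<close>
      have *: "exp (- (3 / 2) * y) \<le> 1 - y" if "0 \<le> y" "y \<le> 1 / 4" for y :: real
      proof -
        have "- (3 / 2) * y \<le> - y - 2 * y\<^sup>2"
          using mult_left_mono[OF that(2) that(1)] by (simp add: power2_eq_square)
        also have "\<dots> \<le> ln (1 - y)" using that by (intro ln_one_minus_pos_lower_bound) auto
        finally have "exp (- (3 / 2) * y) \<le> exp (ln (1 - y))" by simp
        then show ?thesis using that by simp
      qed
      have "v \<in> \<Union>\<C>" using \<open>v \<in> C\<close> bC by blast
      then show "0 \<le> exp (- (3 / 2) * (a v * of_bool (\<sigma> \<inter> Q v = R b v))) \<and>
          exp (- (3 / 2) * (a v * of_bool (\<sigma> \<inter> Q v = R b v))) \<le> 1 - a v * of_bool (\<sigma> \<inter> Q v = R b v)"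
        using *[of "a v * of_bool (\<sigma> \<inter> Q v = R b v)"] a[of v] by (cases "\<sigma> \<inter> Q v = R b v") simp_all
    qed
    finally have "exp (- (3 / 16 * x)) * exp (3 / 16 * x) \<le> w (b, C) \<sigma>"
      unfolding w_def by (simp add: mult_right_mono del: exp_le_cancel_iff)
    then show False using \<sigma>(2)[of "(b, C)"] bC by (simp flip: exp_add)
  qed
  then show ?thesis using \<sigma>(1) by blast
qed

section \<open>Matching through disjoint classes\<close>

text \<open>Greedy choice: picking \<open>v\<close> rules out, besides \<open>v\<close>, at most
  \<open>\<Delta>\<close> indices for each of the at most \<open>k\<close> elements of
  \<open>Q v\<close>.\<close>

lemma ex_disjoint_subfamily:
  assumes "finite U"
    and Q: "\<And>v. v \<in> U \<Longrightarrow> finite (Q v) \<and> card (Q v) \<le> k"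
    and mult: "\<And>x. card {v \<in> U. x \<in> Q v} \<le> \<Delta>"
    and "s * (k * \<Delta> + 1) \<le> card U"
  shows "\<exists>C\<subseteq>U. card C = s \<and> disjoint_family_on Q C"
  using assms
proof (induction s arbitrary: U)
  case 0
  then show ?case by (intro exI[of _ "{}"]) (simp add: disjoint_family_on_def)
next
  case (Suc s)
  then have "U \<noteq> {}" by auto
  then obtain v where v: "v \<in> U" by blast
  \<comment> \<open>\<open>v\<close> is inserted explicitly because it is missing from the union
    when \<open>Q v\<close> is empty.\<close>
  define Z where "Z = insert v (\<Union>x\<in>Q v. {u \<in> U. x \<in> Q u})"
  have Zsub: "Z \<subseteq> U" using v by (auto simp: Z_def)
  have "card Z \<le> card (\<Union>x\<in>Q v. {u \<in> U. x \<in> Q u}) + 1"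
    using Suc.prems(1,2) v by (auto simp: Z_def card_insert_if)
  also have "card (\<Union>x\<in>Q v. {u \<in> U. x \<in> Q u}) \<le> (\<Sum>x\<in>Q v. card {u \<in> U. x \<in> Q u})"
    using Suc.prems(2) v by (intro card_UN_le) auto
  also have "\<dots> \<le> (\<Sum>x\<in>Q v. \<Delta>)" using Suc.prems(3) by (intro sum_mono) auto
  also have "\<dots> \<le> k * \<Delta>" using Suc.prems(2) v by simp
  finally have cardZ: "card Z \<le> k * \<Delta> + 1" by simp
  have mono: "card {u \<in> U - Z. x \<in> Q u} \<le> \<Delta>" for x
  proof -
    have "card {u \<in> U - Z. x \<in> Q u} \<le> card {u \<in> U. x \<in> Q u}"
      by (rule card_mono) (use Suc.prems(1) in auto)
    then show ?thesis using Suc.prems(3)[of x] by linarith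
  qed
  have "card (U - Z) = card U - card Z"
    using Zsub Suc.prems(1) finite_subset by (intro card_Diff_subset) auto
  then have "s * (k * \<Delta> + 1) \<le> card (U - Z)" using cardZ Suc.prems(4) by simp
  then obtain C where C: "C \<subseteq> U - Z" "card C = s" "disjoint_family_on Q C"
    using Suc.IH[of "U - Z"] Suc.prems(1,2) mono by blast
  have vC: "v \<notin> C" using C by (auto simp: Z_def)
  have "Q v \<inter> Q u = {}" if "u \<in> C" for u using that C by (auto simp: Z_def)
  then have "disjoint_family_on Q (insert v C)"
    using vC C by (auto simp: disjoint_family_on_insert)
  moreover have "card (insert v C) = Suc s"
    using vC C Suc.prems(1) by (metis Diff_subset card_insert_disjoint finite_subset)
  moreover have "insert v C \<subseteq> U" using C v by auto
  ultimately show ?case by blast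
qed

text \<open>Classes are split off while enough indices remain. All have the same size
  \<open>s\<close>, so that one tail bound serves every class, and the uncovered remainder is
  small.\<close>

lemma ex_disjoint_classes:
  assumes "finite U" "0 < s"
    and Q: "\<And>v. v \<in> U \<Longrightarrow> finite (Q v) \<and> card (Q v) \<le> k"
    and mult: "\<And>x. card {v \<in> U. x \<in> Q v} \<le> \<Delta>"
  shows "\<exists>\<C>. disjoint \<C> \<and> \<Union>\<C> \<subseteq> U \<and> card U \<le> card (\<Union>\<C>) + s * (k * \<Delta> + 1) \<and>
    (\<forall>C\<in>\<C>. card C = s \<and> disjoint_family_on Q C)"
  using assms
proof (induction "card U" arbitrary: U rule: less_induct)
  case less
  show ?case
  proof (cases "s * (k * \<Delta> + 1) \<le> card U")
    case False
    then show ?thesis by (intro exI[of _ "{}"]) simp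
  next
    case True
    then obtain C where C: "C \<subseteq> U" "card C = s" "disjoint_family_on Q C"
      using ex_disjoint_subfamily[OF less.prems(1,3,4), where s = s] by blast
    have finC: "finite C" using C less.prems(1) finite_subset by blast
    have CU: "card (U - C) = card U - s" "card C \<le> card U"
      using C finC less.prems(1) by (auto simp: card_Diff_subset intro: card_mono)
    have "card {u \<in> U - C. x \<in> Q u} \<le> \<Delta>" for x
    proof -
      have "card {u \<in> U - C. x \<in> Q u} \<le> card {u \<in> U. x \<in> Q u}"
        by (rule card_mono) (use less.prems(1) in auto)
      then show ?thesis using less.prems(4)[of x] by linarith
    qed
    then obtain \<C> where \<C>: "disjoint \<C>" "\<Union>\<C> \<subseteq> U - C"
        "card (U - C) \<le> card (\<Union>\<C>) + s * (k * \<Delta> + 1)"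
        "\<forall>C\<in>\<C>. card C = s \<and> disjoint_family_on Q C"
      using less.hyps[of "U - C"] less.prems CU C by auto
    have "finite (\<Union>\<C>)" using \<C>(2) less.prems(1) finite_subset by blast
    then have "card (C \<union> \<Union>\<C>) = s + card (\<Union>\<C>)"
      using card_Un_disjoint[of C "\<Union>\<C>"] \<C>(2) C finC by auto
    then have "card U \<le> card (\<Union>(insert C \<C>)) + s * (k * \<Delta> + 1)"
      using \<C>(3) CU C by simp
    moreover have "disjoint (insert C \<C>)"
      using \<C>(1,2) by (auto simp: disjoint_def)
    ultimately show ?thesis
      using \<C> C by (intro exI[of _ "insert C \<C>"]) auto
  qed
qed

text \<open>Weighted Hall with weights 2^|Q v| and threshold |L| / 4. The random \<sigma> gives
  every \<open>b\<close> at least half the size of each class, and the classes cover at least half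
  of \<open>L\<close>; the balance of \<open>\<tau>\<close> bounds the weight that any
  \<open>v\<close> can absorb.\<close>

lemma ex_matching_of_balanced_family:
  fixes P :: "'a set" and B :: "'b set" and L :: "'v set"
  assumes fin: "finite P" "finite B" "finite L"
    and \<tau>: "\<And>Q R. Q \<subseteq> P \<Longrightarrow> card Q \<le> k \<Longrightarrow> R \<subseteq> Q \<Longrightarrow>
      2 ^ card Q * real (card {b \<in> B. \<tau> b \<inter> Q = R}) \<le> 4 * real (card B)"
    and Q: "\<And>v. v \<in> L \<Longrightarrow> Q v \<subseteq> P \<and> card (Q v) \<le> k"
    and mult: "\<And>x. card {v \<in> L. x \<in> Q v} \<le> \<Delta>"
    and s: "0 < s" "2 * (s * (k * \<Delta> + 1)) \<le> card L"
    and B: "16 * card B \<le> card L"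
    and small: "real (card B) * real (card L) * exp (- (real s / 2 ^ k / 16)) < 1"
  shows "\<exists>\<sigma>\<subseteq>P. \<exists>g. inj_on g B \<and>
    (\<forall>b\<in>B. g b \<in> L \<and> (\<forall>x\<in>Q (g b). x \<in> \<sigma> \<longleftrightarrow> (x \<in> \<nu> (g b) \<longleftrightarrow> x \<in> \<tau> b)))"
proof -
  have Q': "finite (Q v) \<and> card (Q v) \<le> k" if "v \<in> L" for v
    using Q[OF that] fin finite_subset by blast
  obtain \<C> where \<C>: "disjoint \<C>" "\<Union>\<C> \<subseteq> L" "card L \<le> card (\<Union>\<C>) + s * (k * \<Delta> + 1)"
      "\<And>C. C \<in> \<C> \<Longrightarrow> card C = s \<and> disjoint_family_on Q C"
    using ex_disjoint_classes[OF fin(3) s(1) Q' mult] by metis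
  have finU: "finite (\<Union>\<C>)" using \<C>(2) fin(3) finite_subset by blast
  then have fin\<C>: "finite \<C>" by (rule finite_UnionD)
  have finC: "finite C" if "C \<in> \<C>" for C using finU that by (meson Union_upper finite_subset)
  have "card (\<Union>\<C>) = (\<Sum>C\<in>\<C>. card C)"
    using \<C>(1) finC by (intro card_Union_disjoint) (auto simp: disjoint_def pairwise_def disjnt_def)
  then have cardU: "card (\<Union>\<C>) = card \<C> * s" using \<C>(4) by simp
  \<comment> \<open>Classes are nonempty, so there are at most |L| of them for the union
    bound.\<close>
  have "card \<C> \<le> card (\<Union>\<C>)" using s by (simp add: cardU)
  also have "\<dots> \<le> card L" using \<C>(2) fin(3) by (rule card_mono[rotated])
  finally have card\<C>: "card \<C> \<le> card L" .
  \<comment> \<open>The placement condition solved for \<open>\<sigma>\<close>: \<open>v\<close>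
    fits on \<open>b\<close> iff \<open>\<sigma>\<close> has trace \<open>R b v\<close> on
    \<open>Q v\<close>.\<close>
  define R where "R = (\<lambda>b v. {x \<in> Q v. x \<in> \<nu> v \<longleftrightarrow> x \<in> \<tau> b})"
  have "real (card B) * real (card \<C>) * exp (- (real s / 2 ^ k / 16))
      \<le> real (card B) * real (card L) * exp (- (real s / 2 ^ k / 16))"
    using card\<C> by (intro mult_left_mono mult_right_mono) auto
  then have "real (card B) * real (card \<C>) * exp (- (real s / 2 ^ k / 16)) < 1"
    using small by linarith
  then have "\<exists>\<sigma>\<subseteq>P. \<forall>b\<in>B. \<forall>C\<in>\<C>. real s / 2 \<le> (\<Sum>v | v \<in> C \<and> \<sigma> \<inter> Q v = R b v. 2 ^ card (Q v))"
    using fin fin\<C> \<C> Q finC by (intro ex_subset_meeting_patterns) (auto simp: R_def)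
  then obtain \<sigma> where \<sigma>: "\<sigma> \<subseteq> P"
      "\<And>b C. b \<in> B \<Longrightarrow> C \<in> \<C> \<Longrightarrow> real s / 2 \<le> (\<Sum>v | v \<in> C \<and> \<sigma> \<inter> Q v = R b v. 2 ^ card (Q v))"
    by blast
  have "\<exists>g. inj_on g B \<and> (\<forall>b\<in>B. g b \<in> L \<and> \<sigma> \<inter> Q (g b) = R b (g b))"
  proof (rule ex_injective_choice_of_weights[OF fin(2,3), where w = "\<lambda>v. 2 ^ card (Q v)"])
    have "1 \<le> s * (k * \<Delta> + 1)" using s(1) by simp
    then show "0 < real (card L) / 4" using s(2) by linarith
    show "0 \<le> (2::real) ^ card (Q v)" for v by simp
    show "real (card L) / 4 \<le> (\<Sum>v | v \<in> L \<and> \<sigma> \<inter> Q v = R b v. 2 ^ card (Q v))" if b: "b \<in> B" for b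
    proof -
      define h :: "'v \<Rightarrow> real" where "h = (\<lambda>v. if \<sigma> \<inter> Q v = R b v then 2 ^ card (Q v) else 0)"
      have h: "(\<Sum>v | v \<in> A \<and> \<sigma> \<inter> Q v = R b v. 2 ^ card (Q v)) = sum h A" if "finite A" for A
        using that by (simp add: h_def sum.inter_filter)
      have "real (card L) / 4 \<le> real (card (\<Union>\<C>)) / 2"
        using \<C>(3) s(2) by linarith
      also have "\<dots> = (\<Sum>C\<in>\<C>. real s / 2)" by (simp add: cardU)
      also have "\<dots> \<le> (\<Sum>C\<in>\<C>. sum h C)"
        using \<sigma>(2)[OF b] h finC by (intro sum_mono) auto
      also have "\<dots> = sum h (\<Union>\<C>)"
        using \<C>(1) finC by (subst sum.Union_disjoint) (auto simp: disjoint_def)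
      also have "\<dots> \<le> sum h L"
        using \<C>(2) fin by (intro sum_mono2) (auto simp: h_def)
      finally show ?thesis using h[OF fin(3)] by simp
    qed
    show "2 ^ card (Q v) * real (card {b \<in> B. \<sigma> \<inter> Q v = R b v}) \<le> real (card L) / 4"
      if v: "v \<in> L" for v
    proof -
      let ?R = "{x \<in> Q v. x \<in> \<nu> v \<longleftrightarrow> x \<in> \<sigma>}"
      \<comment> \<open>The condition is a parity of three memberships, so it can equally be solved
        for \<open>\<tau> b\<close>; this makes the balance of \<open>\<tau>\<close>
        applicable.\<close>
      have eq: "\<sigma> \<inter> Q v = R b v \<longleftrightarrow> \<tau> b \<inter> Q v = ?R" for b
        unfolding R_def set_eq_iff by blast
      have "2 ^ card (Q v) * real (card {b \<in> B. \<tau> b \<inter> Q v = ?R}) \<le> 4 * real (card B)"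
        using Q[OF v] by (intro \<tau>) auto
      also have "\<dots> \<le> real (card L) / 4" using B by linarith
      finally show ?thesis by (simp only: eq)
    qed
  qed
  then obtain g where g: "inj_on g B" "\<And>b. b \<in> B \<Longrightarrow> g b \<in> L"
      "\<And>b. b \<in> B \<Longrightarrow> \<sigma> \<inter> Q (g b) = R b (g b)"
    by blast
  have "x \<in> \<sigma> \<longleftrightarrow> (x \<in> \<nu> (g b) \<longleftrightarrow> x \<in> \<tau> b)" if "b \<in> B" "x \<in> Q (g b)" for b x
    using g(3)[OF that(1)] that(2) unfolding R_def set_eq_iff by blast
  then show ?thesis using \<sigma>(1) g by blast
qed

section \<open>Embedding into the host graph\<close>

text \<open>Greedy pairing: a vertex excludes at most \<open>d + 1\<close> partners, itself
  included, and removing a pair costs two vertices, so the size condition is inherited.\<close>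

lemma ex_pairing_avoiding:
  fixes S :: "'a set"
  assumes "finite S"
    and "\<And>u. u \<in> S \<Longrightarrow> card {u' \<in> S. r u u'} \<le> d"
    and "2 * q + d \<le> card S"
  shows "\<exists>c. inj_on c ({..<q} \<times> (UNIV :: bool set)) \<and> c ` ({..<q} \<times> UNIV) \<subseteq> S \<and>
    (\<forall>x<q. \<not> r (c (x, False)) (c (x, True)))"
  using assms
proof (induction q arbitrary: S)
  case 0
  then show ?case by auto
next
  case (Suc q)
  then have "S \<noteq> {}" by auto
  then obtain u where u: "u \<in> S" by blast
  have "card (insert u {u' \<in> S. r u u'}) \<le> d + 1"
    using Suc.prems(1) Suc.prems(2)[OF u] by (auto simp: card_insert_if)
  then have "card (insert u {u' \<in> S. r u u'}) < card S" using Suc.prems(3) by simp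
  then have "\<not> S \<subseteq> insert u {u' \<in> S. r u u'}"
    using Suc.prems(1) card_mono[of "insert u {u' \<in> S. r u u'}" S] by auto
  then obtain u' where u': "u' \<in> S" "u' \<noteq> u" "\<not> r u u'" by blast
  have "card {z \<in> S - {u, u'}. r y z} \<le> d" if "y \<in> S - {u, u'}" for y
  proof -
    have "card {z \<in> S - {u, u'}. r y z} \<le> card {z \<in> S. r y z}"
      by (rule card_mono) (use Suc.prems(1) in auto)
    then show ?thesis using Suc.prems(2)[of y] that by simp
  qed
  moreover have "2 * q + d \<le> card (S - {u, u'})"
    using u u' Suc.prems(1,3) by (simp add: card_Diff_subset)
  ultimately obtain c where c: "inj_on c ({..<q} \<times> (UNIV :: bool set))"
      "c ` ({..<q} \<times> UNIV) \<subseteq> S - {u, u'}" "\<forall>x<q. \<not> r (c (x, False)) (c (x, True))"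
    using Suc.IH[of "S - {u, u'}"] Suc.prems(1) by blast
  define c' where "c' = (\<lambda>(x, i). if x < q then c (x, i) else if i then u' else u)"
  have cS: "c (x, i) \<in> S" "c (x, i) \<noteq> u" "c (x, i) \<noteq> u'" if "x < q" for x i
    using c(2) that by (auto simp: image_subset_iff)
  have "inj_on c' ({..<Suc q} \<times> UNIV)"
  proof (rule inj_onI)
    fix y z :: "nat \<times> bool"
    assume yz: "y \<in> {..<Suc q} \<times> UNIV" "z \<in> {..<Suc q} \<times> UNIV" "c' y = c' z"
    obtain x i x' i' where xi: "y = (x, i)" "z = (x', i')" by (meson surj_pair)
    show "y = z"
    proof (cases "x < q \<and> x' < q")
      case True
      then show ?thesis using yz c(1) by (auto simp: xi c'_def inj_on_def)
    next
      case False
      then show ?thesis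
        using yz cS[of x i] cS[of x' i'] u'(2) by (auto simp: xi c'_def less_Suc_eq split: if_splits)
    qed
  qed
  moreover have "c' ` ({..<Suc q} \<times> UNIV) \<subseteq> S" using cS u u' by (auto simp: c'_def)
  moreover have "\<forall>x<Suc q. \<not> r (c' (x, False)) (c' (x, True))"
    using c(3) u' by (auto simp: c'_def less_Suc_eq)
  ultimately show ?case by blast
qed

section \<open>Degree counting and the choice of the pairs\<close>

definition nbrs :: "'a set set \<Rightarrow> 'a \<Rightarrow> 'a set" where
  "nbrs F v = {u. {u, v} \<in> F}"

lemma nbrs_sym: "u \<in> nbrs F v \<longleftrightarrow> v \<in> nbrs F u"
  by (simp add: nbrs_def insert_commute)

lemma nbrs_subset: "simple_graph W F \<Longrightarrow> nbrs F v \<subseteq> W"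
  by (auto simp: nbrs_def simple_graph_def)

lemma sum_card_nbrs:
  assumes "simple_graph W F"
  shows "(\<Sum>v\<in>W. card (nbrs F v)) = 2 * card F"
proof -
  have finW: "finite W" and F: "\<And>e. e \<in> F \<Longrightarrow> e \<subseteq> W \<and> card e = 2"
    using assms by (auto simp: simple_graph_def)
  then have finF: "finite F" by (meson PowI finite_Pow_iff finite_subset subsetI)
  have "card (nbrs F v) = card {e \<in> F. v \<in> e}" for v
  proof -
    have "{e \<in> F. v \<in> e} = (\<lambda>u. {u, v}) ` nbrs F v"
    proof (intro equalityI subsetI)
      fix e assume e: "e \<in> {e \<in> F. v \<in> e}"
      then obtain x y where "e = {x, y}" using F[of e] by (auto simp: card_2_iff)
      then have "e = {x, v} \<or> e = {y, v}" using e by auto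
      then show "e \<in> (\<lambda>u. {u, v}) ` nbrs F v" using e by (auto simp: nbrs_def)
    qed (auto simp: nbrs_def)
    moreover have "inj_on (\<lambda>u. {u, v}) (nbrs F v)" by (auto simp: inj_on_def doubleton_eq_iff)
    ultimately show ?thesis by (simp add: card_image)
  qed
  then have "(\<Sum>v\<in>W. card (nbrs F v)) = (\<Sum>v\<in>W. \<Sum>e | e \<in> F \<and> v \<in> e. 1)" by simp
  also have "\<dots> = (\<Sum>e\<in>F. \<Sum>v | v \<in> W \<and> v \<in> e. 1)"
    by (rule sum.swap_restrict[OF finW finF])
  also have "\<dots> = (\<Sum>e\<in>F. 2)"
  proof (intro sum.cong refl)
    fix e assume "e \<in> F"
    then have "{v. v \<in> W \<and> v \<in> e} = e" "card e = 2" using F by auto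
    then show "(\<Sum>v | v \<in> W \<and> v \<in> e. 1) = (2::nat)" by simp
  qed
  finally show ?thesis by simp
qed

text \<open>Markov's inequality is used twice: fewer than half of the vertices have degree above
  \<open>D\<close>, and few vertices have more than \<open>k\<close> neighbours in a set
  \<open>S\<close> of 4p low-degree ones. Only 2p vertices of \<open>S\<close> are used, which
  leaves room to avoid pairs with a common neighbour in \<open>L\<close>.\<close>

lemma ex_low_degree_pairs:
  fixes W :: "'a set"
  assumes G: "simple_graph W F" "card W = n" "card F = m"
    and D: "4 * m < n * (D + 1)"
    and p: "16 * p \<le> n" "16 * (p * D) \<le> n * (k + 1)" "D * k \<le> 2 * p"
  obtains c L where
    "inj_on c ({..<p} \<times> (UNIV :: bool set))" "c ` ({..<p} \<times> UNIV) \<subseteq> W"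
    "L \<subseteq> W" "c ` ({..<p} \<times> UNIV) \<inter> L = {}" "n \<le> 2 * card L"
    "\<And>v. v \<in> L \<Longrightarrow> card (nbrs F v \<inter> c ` ({..<p} \<times> UNIV)) \<le> k"
    "\<And>z. z \<in> {..<p} \<times> UNIV \<Longrightarrow> card (nbrs F (c z)) \<le> D"
    "\<And>v x. v \<in> L \<Longrightarrow> x < p \<Longrightarrow> \<not> (c (x, False) \<in> nbrs F v \<and> c (x, True) \<in> nbrs F v)"
proof -
  have finW: "finite W" using G by (simp add: simple_graph_def)
  have finN: "finite (nbrs F v)" for v using nbrs_subset[OF G(1)] finW finite_subset by blast
  define H where "H = {v \<in> W. D < card (nbrs F v)}"
  \<comment> \<open>The degrees sum to \<open>2 * m\<close>, which is less than
    \<open>n * (D + 1) / 2\<close>.\<close>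
  have "(D + 1) * card H = (\<Sum>v\<in>H. D + 1)" by simp
  also have "\<dots> \<le> (\<Sum>v\<in>H. card (nbrs F v))" by (intro sum_mono) (auto simp: H_def)
  also have "\<dots> \<le> (\<Sum>v\<in>W. card (nbrs F v))"
    using finW by (intro sum_mono2) (auto simp: H_def)
  finally have "(D + 1) * (2 * card H) \<le> 4 * m" using sum_card_nbrs[OF G(1)] G(3) by simp
  then have "(D + 1) * (2 * card H) < (D + 1) * n" using D by (simp add: mult.commute)
  then have "2 * card H < n" by (rule mult_less_cancel1[THEN iffD1, THEN conjunct2])
  moreover have "card (W - H) = n - card H"
    using G(2) finW by (subst card_Diff_subset) (auto simp: H_def)
  ultimately have "4 * p \<le> card (W - H)" using p(1) by linarith
  then obtain S where S: "S \<subseteq> W - H" "card S = 4 * p" "finite S"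
    using obtain_subset_with_card_n by metis
  have degS: "card (nbrs F u) \<le> D" if "u \<in> S" for u
    using S that by (auto simp: H_def not_less)
  \<comment> \<open>\<open>S\<close> has at most 4pD incident edges in all, so at most n/4 vertices
    are bad; \<open>S\<close> itself has at most n/4 vertices, and half of \<open>W\<close> is left
    for \<open>L\<close>.\<close>
  define Bad where "Bad = {v \<in> W. k < card (nbrs F v \<inter> S)}"
  have "(k + 1) * card Bad = (\<Sum>v\<in>Bad. k + 1)" by simp
  also have "\<dots> \<le> (\<Sum>v\<in>Bad. card (nbrs F v \<inter> S))" by (intro sum_mono) (auto simp: Bad_def)
  also have "\<dots> \<le> (\<Sum>v\<in>W. card (nbrs F v \<inter> S))"
    using finW by (intro sum_mono2) (auto simp: Bad_def)
  also have "\<dots> = (\<Sum>v\<in>W. \<Sum>u | u \<in> S \<and> u \<in> nbrs F v. 1)"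
    by (simp add: Int_commute Int_def conj_commute)
  also have "\<dots> = (\<Sum>u\<in>S. \<Sum>v | v \<in> W \<and> u \<in> nbrs F v. 1)"
    by (rule sum.swap_restrict[OF finW S(3)])
  also have "\<dots> \<le> (\<Sum>u\<in>S. D)"
  proof (rule sum_mono)
    fix u assume u: "u \<in> S"
    have "card {v. v \<in> W \<and> u \<in> nbrs F v} \<le> card (nbrs F u)"
      by (rule card_mono[OF finN]) (auto simp: nbrs_sym)
    then show "(\<Sum>v | v \<in> W \<and> u \<in> nbrs F v. 1) \<le> D" using degS[OF u] by simp
  qed
  finally have "(k + 1) * (4 * card Bad) \<le> 16 * (p * D)" using S(2) by simp
  also have "\<dots> \<le> (k + 1) * n" using p(2) by (simp add: mult.commute)
  finally have cardBad: "4 * card Bad \<le> n" by (rule mult_le_cancel1[THEN iffD1, rule_format]) simp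
  define L where "L = W - (S \<union> Bad)"
  have "card (S \<union> Bad) \<le> 4 * p + card Bad" using card_Un_le[of S Bad] S by simp
  moreover have "card L = n - card (S \<union> Bad)"
    unfolding L_def using G(2) finW S by (subst card_Diff_subset) (auto simp: Bad_def)
  ultimately have cardL: "n \<le> 2 * card L" using p(1) cardBad by linarith
  have finL: "finite L" using finW by (simp add: L_def)
  have LS: "card (nbrs F v \<inter> S) \<le> k" if "v \<in> L" for v
    using that by (auto simp: L_def Bad_def)
  \<comment> \<open>A path u - v - u' through \<open>L\<close> has at most \<open>D\<close> choices
    for \<open>v\<close> and then at most \<open>k\<close> for \<open>u'\<close>.\<close>
  define r where "r = (\<lambda>u u'. \<exists>v\<in>L. u \<in> nbrs F v \<and> u' \<in> nbrs F v)"
  have "card {u' \<in> S. r u u'} \<le> D * k" if u: "u \<in> S" for u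
  proof -
    have "{u' \<in> S. r u u'} \<subseteq> (\<Union>v\<in>nbrs F u \<inter> L. nbrs F v \<inter> S)"
      by (auto simp: r_def nbrs_sym)
    then have "card {u' \<in> S. r u u'} \<le> card (\<Union>v\<in>nbrs F u \<inter> L. nbrs F v \<inter> S)"
      by (rule card_mono[rotated]) (use finN in auto)
    also have "\<dots> \<le> (\<Sum>v\<in>nbrs F u \<inter> L. card (nbrs F v \<inter> S))"
      by (rule card_UN_le) (use finN in auto)
    also have "\<dots> \<le> (\<Sum>v\<in>nbrs F u \<inter> L. k)" using LS by (intro sum_mono) auto
    also have "\<dots> \<le> D * k"
      using card_mono[OF finN, of "nbrs F u \<inter> L" u] degS[OF u] by (simp add: mult_le_mono1)
    finally show ?thesis .
  qed
  then obtain c where c: "inj_on c ({..<p} \<times> (UNIV :: bool set))" "c ` ({..<p} \<times> UNIV) \<subseteq> S"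
      "\<forall>x<p. \<not> r (c (x, False)) (c (x, True))"
    using ex_pairing_avoiding[of S r "D * k" p] S p(3) by auto
  show ?thesis
  proof (rule that[of c L])
    show "card (nbrs F v \<inter> c ` ({..<p} \<times> UNIV)) \<le> k" if "v \<in> L" for v
    proof -
      have "card (nbrs F v \<inter> c ` ({..<p} \<times> UNIV)) \<le> card (nbrs F v \<inter> S)"
        using c(2) finN by (intro card_mono) auto
      then show ?thesis using LS[OF that] by linarith
    qed
    show "\<not> (c (x, False) \<in> nbrs F v \<and> c (x, True) \<in> nbrs F v)" if "v \<in> L" "x < p" for v x
      using c(3) that by (auto simp: r_def)
    show "card (nbrs F (c z)) \<le> D" if "z \<in> {..<p} \<times> UNIV" for z
      using degS c(2) that by blast
  qed (use c cardL S in \<open>auto simp: L_def\<close>)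
qed

section \<open>The host graph and placements avoiding its missing edges\<close>

definition missing :: "nat \<Rightarrow> nat \<Rightarrow> (nat \<Rightarrow> nat set) \<Rightarrow> nat set set" where
  "missing p q \<tau> = (\<lambda>(x, b). {2 * x + of_bool (x \<in> \<tau> b), 2 * p + b}) ` ({..<p} \<times> {..<q})"

lemma card_missing: "card (missing p q \<tau>) = p * q"
proof -
  have "x = y \<and> b = d"
    if "x < p" "y < p" and eq: "{2 * x + of_bool (x \<in> \<tau> b), 2 * p + b} = {2 * y + of_bool (y \<in> \<tau> d), 2 * p + d}"
    for x y b d
  proof -
    \<comment> \<open>One endpoint lies below \<open>2 * p\<close> and the other does not, so the
      unordered edge determines which endpoint is which.\<close>
    have lt: "2 * x + of_bool (x \<in> \<tau> b) < 2 * p" "2 * y + of_bool (y \<in> \<tau> d) < 2 * p"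
      using that(1,2) by (simp_all add: of_bool_def)
    then have "2 * p + b = 2 * p + d \<and> 2 * x + of_bool (x \<in> \<tau> b) = 2 * y + of_bool (y \<in> \<tau> d)"
      using eq unfolding doubleton_eq_iff by linarith
    then show ?thesis by (auto simp: of_bool_def split: if_splits; presburger)
  qed
  then have "inj_on (\<lambda>(x, b). {2 * x + of_bool (x \<in> \<tau> b), 2 * p + b}) ({..<p} \<times> {..<q})"
    unfolding inj_on_def by (simp add: split_paired_Ball_Sigma)
  then show ?thesis by (simp add: missing_def card_image)
qed

lemma missing_subset:
  assumes "2 * p + q \<le> n"
  shows "missing p q \<tau> \<subseteq> {e. e \<subseteq> {..<n} \<and> card e = 2}"
proof
  fix e assume "e \<in> missing p q \<tau>"
  then obtain x b where xb: "x < p" "b < q" "e = {2 * x + of_bool (x \<in> \<tau> b), 2 * p + b}"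
    by (auto simp: missing_def)
  then have "2 * x + of_bool (x \<in> \<tau> b) < 2 * p" by (simp add: of_bool_def)
  then show "e \<in> {e. e \<subseteq> {..<n} \<and> card e = 2}" using xb assms by auto
qed

text \<open>The placement is built backwards, from host vertices to \<open>W\<close>, and completed
  by any bijection on the remaining vertices: missing edges only join the pairs to the
  \<open>q\<close> special vertices, so \<open>avoid\<close> is the only constraint.\<close>

lemma contains_copy_of_assignment:
  fixes W :: "'a set"
  assumes G: "simple_graph W F" "card W = n"
    and n: "2 * p + q \<le> n"
    and c: "inj_on c ({..<p} \<times> (UNIV :: bool set))" "c ` ({..<p} \<times> UNIV) \<subseteq> W"
    and g: "inj_on g {..<q}" "g ` {..<q} \<subseteq> W" "c ` ({..<p} \<times> UNIV) \<inter> g ` {..<q} = {}"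
    and avoid: "\<And>x b i. x < p \<Longrightarrow> b < q \<Longrightarrow> {c (x, i), g b} \<in> F \<Longrightarrow>
      (i \<noteq> (x \<in> \<sigma>)) \<noteq> (x \<in> \<tau> b)"
  shows "contains_copy {..<n} ({e. e \<subseteq> {..<n} \<and> card e = 2} - missing p q \<tau>) W F"
proof -
  have finW: "finite W" and F: "\<And>e. e \<in> F \<Longrightarrow> e \<subseteq> W \<and> card e = 2"
    using G by (auto simp: simple_graph_def)
  \<comment> \<open>\<open>\<sigma>\<close> flips a pair: \<open>c (x, i)\<close> sits on the odd
    vertex of pair \<open>x\<close> iff \<open>i \<noteq> (x \<in> \<sigma>)\<close>.\<close>
  define h where "h = (\<lambda>y. if y < 2 * p then c (y div 2, odd y \<noteq> (y div 2 \<in> \<sigma>)) else g (y - 2 * p))"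
  have inj: "inj_on h {..<2 * p + q}"
  proof (rule inj_onI)
    fix y z assume yz: "y \<in> {..<2 * p + q}" "z \<in> {..<2 * p + q}" "h y = h z"
    have cross: False if "u < 2 * p" "\<not> w < 2 * p" "w < 2 * p + q" "h u = h w" for u w
    proof -
      have "h u \<in> c ` ({..<p} \<times> UNIV)" using that(1) by (auto simp: h_def)
      moreover have "h w \<in> g ` {..<q}" using that(2,3) by (auto simp: h_def)
      ultimately show False using g(3) that(4) by auto
    qed
    consider "y < 2 * p \<longleftrightarrow> \<not> z < 2 * p" | "y < 2 * p" "z < 2 * p" | "\<not> y < 2 * p" "\<not> z < 2 * p"
      by blast
    then show "y = z"
    proof cases
      case 1
      then show ?thesis using cross[of y z] cross[of z y] yz by auto
    next
      case 2
      then have "(y div 2, odd y \<noteq> (y div 2 \<in> \<sigma>)) = (z div 2, odd z \<noteq> (z div 2 \<in> \<sigma>))"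
        using yz by (intro inj_onD[OF c(1)]) (auto simp: h_def)
      then have "y div 2 = z div 2" "odd y = odd z" by auto
      then show ?thesis by presburger
    next
      case 3
      then have "y - 2 * p = z - 2 * p"
        using yz by (intro inj_onD[OF g(1)]) (auto simp: h_def)
      then show ?thesis using 3 by simp
    qed
  qed
  have hW: "h ` {..<2 * p + q} \<subseteq> W"
  proof -
    have "h y \<in> W" if "y < 2 * p + q" for y
      using that c(2) g(2) by (auto simp: h_def image_subset_iff)
    then show ?thesis by auto
  qed
  have "card {2 * p + q..<n} = card (W - h ` {..<2 * p + q})"
    using G(2) finW hW inj by (simp add: card_Diff_subset card_image finite_subset)
  then obtain h2 where h2: "bij_betw h2 {2 * p + q..<n} (W - h ` {..<2 * p + q})"
    using finite_same_card_bij[of "{2 * p + q..<n}" "W - h ` {..<2 * p + q}"] finW by auto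
  define h' where "h' = (\<lambda>y. if y < 2 * p + q then h y else h2 y)"
  have "bij_betw h' ({..<2 * p + q} \<union> {2 * p + q..<n})
      (h ` {..<2 * p + q} \<union> (W - h ` {..<2 * p + q}))"
  proof (rule bij_betw_combine)
    show "bij_betw h' {..<2 * p + q} (h ` {..<2 * p + q})"
      using inj by (auto simp: bij_betw_def h'_def inj_on_def image_def)
    show "bij_betw h' {2 * p + q..<n} (W - h ` {..<2 * p + q})"
      using h2 by (rule bij_betw_cong[THEN iffD1, rotated]) (auto simp: h'_def)
  qed auto
  moreover have "{..<2 * p + q} \<union> {2 * p + q..<n} = {..<n}" using n by auto
  moreover have "h ` {..<2 * p + q} \<union> (W - h ` {..<2 * p + q}) = W" using hW by blast
  ultimately have bij: "bij_betw h' {..<n} W" by simp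
  define f where "f = inv_into {..<n} h'"
  have f: "bij_betw f W {..<n}" unfolding f_def using bij by (rule bij_betw_inv_into)
  have hf: "h' (f u) = u" if "u \<in> W" for u
    unfolding f_def using bij that by (rule bij_betw_inv_into_right)
  have "f ` e \<notin> missing p q \<tau>" if e: "e \<in> F" for e
  proof
    assume "f ` e \<in> missing p q \<tau>"
    then obtain x b where xb: "x < p" "b < q" "f ` e = {2 * x + of_bool (x \<in> \<tau> b), 2 * p + b}"
      by (auto simp: missing_def)
    \<comment> \<open>The vertices sitting on the ends of the missing edge are recovered; they form
      exactly the configuration excluded by \<open>avoid\<close>.\<close>
    have "e = h' ` f ` e" using F[OF e] hf by (force simp: image_image)
    also have "\<dots> = {c (x, (x \<in> \<tau> b) \<noteq> (x \<in> \<sigma>)), g b}"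
      using xb by (auto simp: h'_def h_def of_bool_def)
    finally show False using avoid[of x b "(x \<in> \<tau> b) \<noteq> (x \<in> \<sigma>)"] xb e by auto
  qed
  moreover have "f ` e \<subseteq> {..<n} \<and> card (f ` e) = 2" if "e \<in> F" for e
    using F[OF that] f by (metis bij_betw_def card_image image_mono inj_on_subset)
  ultimately show ?thesis
    unfolding contains_copy_def using f
    by (intro exI[of _ f]) (auto simp: bij_betw_def)
qed

text \<open>\<open>\<tau>\<close> is fixed before \<open>F\<close>; the pairs,
  \<open>\<sigma>\<close> and \<open>g\<close> then depend on \<open>F\<close>. The set
  \<open>L\<close> has at least n/2 elements, and a pair meets at most \<open>2 * D\<close>
  neighbourhoods, which explains the constants in the assumptions on \<open>q\<close> and
  \<open>s\<close>.\<close>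

lemma universal_complement_missing:
  assumes \<tau>: "\<And>Q R. Q \<subseteq> {..<p} \<Longrightarrow> card Q \<le> k \<Longrightarrow> R \<subseteq> Q \<Longrightarrow>
      2 ^ card Q * real (card {b \<in> {..<q}. \<tau> b \<inter> Q = R}) \<le> 4 * real q"
    and D: "4 * m < n * (D + 1)"
    and p: "16 * p \<le> n" "16 * (p * D) \<le> n * (k + 1)" "D * k \<le> 2 * p"
    and q: "32 * q \<le> n"
    and s: "0 < s" "4 * (s * (2 * (k * D) + 1)) \<le> n"
    and small: "real q * real n * exp (- (real s / 2 ^ k / 16)) < 1"
  shows "universal n m {..<n} ({e. e \<subseteq> {..<n} \<and> card e = 2} - missing p q \<tau>)"
  unfolding universal_def
proof (intro allI impI, elim conjE)
  fix W :: "nat set" and F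
  assume G: "simple_graph W F" "card W = n" "card F = m"
  have finW: "finite W" using G by (simp add: simple_graph_def)
  have finN: "finite (nbrs F v)" for v using nbrs_subset[OF G(1)] finW finite_subset by blast
  obtain c L where c: "inj_on c ({..<p} \<times> (UNIV :: bool set))" "c ` ({..<p} \<times> UNIV) \<subseteq> W"
    and L: "L \<subseteq> W" "c ` ({..<p} \<times> UNIV) \<inter> L = {}" "n \<le> 2 * card L"
    and Lk: "\<And>v. v \<in> L \<Longrightarrow> card (nbrs F v \<inter> c ` ({..<p} \<times> UNIV)) \<le> k"
    and cD: "\<And>z. z \<in> {..<p} \<times> UNIV \<Longrightarrow> card (nbrs F (c z)) \<le> D"
    and cL: "\<And>v x. v \<in> L \<Longrightarrow> x < p \<Longrightarrow> \<not> (c (x, False) \<in> nbrs F v \<and> c (x, True) \<in> nbrs F v)"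
    using ex_low_degree_pairs[OF G D p] by metis
  have finL: "finite L" using L finW finite_subset by blast
  define Q where "Q = (\<lambda>v. {x. x < p \<and> (\<exists>i. c (x, i) \<in> nbrs F v)})"
  \<comment> \<open>No \<open>v\<close> in \<open>L\<close> is adjacent to both vertices of a pair,
    so for pairs in \<open>Q v\<close> this records which of the two is the neighbour.\<close>
  define \<nu> where "\<nu> = (\<lambda>v. {x. c (x, True) \<in> nbrs F v})"
  have Qk: "Q v \<subseteq> {..<p} \<and> card (Q v) \<le> k" if v: "v \<in> L" for v
  proof -
    let ?Z = "{z \<in> {..<p} \<times> (UNIV :: bool set). c z \<in> nbrs F v}"
    have "Q v = fst ` ?Z" by (force simp: Q_def)
    then have "card (Q v) \<le> card ?Z" by (simp add: card_image_le)
    also have "\<dots> = card (c ` ?Z)"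
      using inj_on_subset[OF c(1), of ?Z] by (simp add: card_image)
    also have "\<dots> \<le> card (nbrs F v \<inter> c ` ({..<p} \<times> UNIV))"
      using finN by (intro card_mono) auto
    finally show ?thesis using Lk[OF v] by (auto simp: Q_def)
  qed
  have mult: "card {v \<in> L. x \<in> Q v} \<le> 2 * D" for x
  proof (cases "x < p")
    case True
    have "{v \<in> L. x \<in> Q v} \<subseteq> nbrs F (c (x, False)) \<union> nbrs F (c (x, True))"
    proof
      fix v assume "v \<in> {v \<in> L. x \<in> Q v}"
      then obtain i where "c (x, i) \<in> nbrs F v" by (auto simp: Q_def)
      then have "v \<in> nbrs F (c (x, i))" by (simp add: nbrs_sym)
      then show "v \<in> nbrs F (c (x, False)) \<union> nbrs F (c (x, True))" by (cases i) auto
    qed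
    then have "card {v \<in> L. x \<in> Q v} \<le> card (nbrs F (c (x, False)) \<union> nbrs F (c (x, True)))"
      by (rule card_mono[rotated]) (use finN in auto)
    also have "\<dots> \<le> card (nbrs F (c (x, False))) + card (nbrs F (c (x, True)))" by (rule card_Un_le)
    also have "\<dots> \<le> 2 * D" using cD[of "(x, False)"] cD[of "(x, True)"] True by auto
    finally show ?thesis .
  qed (simp add: Q_def)
  have "card L \<le> n" using card_mono[OF finW L(1)] G(2) by simp
  then have "real q * real (card L) * exp (- (real s / 2 ^ k / 16))
      \<le> real q * real n * exp (- (real s / 2 ^ k / 16))"
    by (intro mult_left_mono mult_right_mono) auto
  then have small': "real (card {..<q}) * real (card L) * exp (- (real s / 2 ^ k / 16)) < 1"
    using small by (simp only: card_lessThan)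
  have "2 * (s * (k * (2 * D) + 1)) \<le> card L"
    using s(2) L(3) by (simp add: mult.left_commute)
  then have "\<exists>\<sigma>\<subseteq>{..<p}. \<exists>g. inj_on g {..<q} \<and>
      (\<forall>b\<in>{..<q}. g b \<in> L \<and> (\<forall>x\<in>Q (g b). x \<in> \<sigma> \<longleftrightarrow> (x \<in> \<nu> (g b) \<longleftrightarrow> x \<in> \<tau> b)))"
    using Qk mult s(1) small' \<tau> finL q L(3)
    by (intro ex_matching_of_balanced_family[where k = k and \<Delta> = "2 * D" and s = s]) auto
  then obtain \<sigma> g where g: "inj_on g {..<q}" "\<And>b. b < q \<Longrightarrow> g b \<in> L"
      "\<And>b x. b < q \<Longrightarrow> x \<in> Q (g b) \<Longrightarrow> x \<in> \<sigma> \<longleftrightarrow> (x \<in> \<nu> (g b) \<longleftrightarrow> x \<in> \<tau> b)"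
    by (metis lessThan_iff)
  show "contains_copy {..<n} ({e. e \<subseteq> {..<n} \<and> card e = 2} - missing p q \<tau>) W F"
  proof (rule contains_copy_of_assignment[OF G(1,2) _ c g(1)])
    show "2 * p + q \<le> n" using p(1) q by linarith
    have "g ` {..<q} \<subseteq> L" using g(2) by auto
    then show "g ` {..<q} \<subseteq> W" "c ` ({..<p} \<times> UNIV) \<inter> g ` {..<q} = {}" using L(1,2) by blast+
    show "(i \<noteq> (x \<in> \<sigma>)) \<noteq> (x \<in> \<tau> b)" if "x < p" "b < q" "{c (x, i), g b} \<in> F" for x b i
    proof -
      have i: "c (x, i) \<in> nbrs F (g b)" using that(3) by (simp add: nbrs_def)
      then have "x \<in> \<nu> (g b) \<longleftrightarrow> i"
        using cL[OF g(2)[OF that(2)] that(1)] by (cases i) (auto simp: \<nu>_def)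
      moreover have "x \<in> Q (g b)" using i that by (auto simp: Q_def)
      ultimately show ?thesis using g(3)[OF that(2)] by blast
    qed
  qed
qed

section \<open>Choice of the parameters\<close>

text \<open>Take \<open>q\<close> about n/32; the required number of missing edges then makes
  \<open>p\<close> about \<epsilon> n^2 ln n / (128 m). \<open>D\<close> is about 4m/n and
  \<open>k\<close> about \<epsilon> ln n, whence 2^k \<le> n^\<epsilon>. Thus q / 2^k and s / 2^k
  are powers of \<open>n\<close> up to logarithms, which makes both failure bounds small.\<close>

lemma ex_parameters:
  fixes \<epsilon> :: real
  assumes \<epsilon>: "0 < \<epsilon>" "\<epsilon> < 1 / 2"
  shows "\<forall>\<^sub>F n :: nat in sequentially. \<forall>m. real n * ln (real n) < real m \<longrightarrow> real m < real n powr (3 / 2 - \<epsilon>) \<longrightarrow>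
    (\<exists>p q k D s :: nat.
      \<epsilon> * real n ^ 3 * ln (real n) / (2 ^ 12 * real m) \<le> real (p * q) \<and>
      (2 * (real p + 1)) ^ k * exp (- real q / 2 ^ k) < 1 \<and>
      4 * m < n * (D + 1) \<and>
      16 * p \<le> n \<and> 16 * (p * D) \<le> n * (k + 1) \<and> D * k \<le> 2 * p \<and> 32 * q \<le> n \<and>
      0 < s \<and> 4 * (s * (2 * (k * D) + 1)) \<le> n \<and>
      real q * real n * exp (- (real s / 2 ^ k / 16)) < 1)"
proof -
  \<comment> \<open>A lower bound for \<open>s\<close> depending on \<open>n\<close> alone: 32 = 4 *
    2 * 4 from D \<le> 4 n^(1/2 - \<epsilon>), and the -1 pays for rounding down.\<close>
  define S where "S = (\<lambda>n :: nat. real n / (32 * (\<epsilon> * ln (real n)) * real n powr (1 / 2 - \<epsilon>) + 4) - 1)"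
  \<comment> \<open>For \<open>pD\<close>: rounding \<open>p\<close> up costs 64 m / n, and the main
    term 33/64 leaves the slack 31/64.\<close>
  have ev1: "\<forall>\<^sub>F n :: nat in sequentially. 64 * real n powr (1 / 2 - \<epsilon>) \<le> 31 / 64 * \<epsilon> * real n * ln (real n)"
    using \<epsilon> by real_asymp
  \<comment> \<open>For \<open>Dk\<close>: this compares m/n with n^2/m and is where the exponent
    3/2 - \<epsilon> is needed.\<close>
  have ev2: "\<forall>\<^sub>F n :: nat in sequentially. 256 * real n powr (1 / 2 - \<epsilon>) \<le> real n powr (1 / 2 + \<epsilon>)"
    using \<epsilon> by real_asymp
  have ev3: "\<forall>\<^sub>F n :: nat in sequentially. 0 < S n"
    unfolding S_def using \<epsilon> by real_asymp
  have ev4: "\<forall>\<^sub>F n :: nat in sequentially. 16 * (2 * ln (real n)) < S n * real n powr - \<epsilon>"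
    unfolding S_def using \<epsilon> by real_asymp
  have ev5: "\<forall>\<^sub>F n :: nat in sequentially. \<epsilon> * ln (real n) * ln (real n) < real n / 33 * real n powr - \<epsilon>"
    using \<epsilon> by real_asymp
  show ?thesis
    using ev1 ev2 ev3 ev4 ev5 eventually_ge_at_top[of "1056 :: nat"]
  proof eventually_elim
    case (elim n)
    define L where "L = ln (real n)"
    have n: "1056 \<le> real n" "0 < real n" using elim(6) by simp_all
    have L: "0 < L" using n by (simp add: L_def)
    show ?case
    proof (intro allI impI)
      fix m assume m: "real n * ln (real n) < real m" "real m < real n powr (3 / 2 - \<epsilon>)"
      have "0 < real n * L" using n L by simp
      also have nL: "real n * L < real m" using m(1) by (simp add: L_def)
      finally have m0: "0 < real m" .
      have "real n powr (3 / 2 - \<epsilon>) = real n * real n powr (1 / 2 - \<epsilon>)"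
        using n powr_add[of "real n" 1 "1 / 2 - \<epsilon>"] by simp
      then have mn: "real m / real n \<le> real n powr (1 / 2 - \<epsilon>)"
        using m(2) n by (simp add: field_simps)
      \<comment> \<open>\<open>M\<close> is the number of edges that must be missing;
        \<open>p\<close> is M/q rounded up.\<close>
      define M where "M = \<epsilon> * real n ^ 3 * L / (2 ^ 12 * real m)"
      define Y where "Y = \<epsilon> * L * real n ^ 2 / real m"
      define q where "q = n div 32"
      define p where "p = nat \<lceil>M / real q\<rceil>"
      define k where "k = nat \<lfloor>\<epsilon> * L\<rfloor>"
      define D where "D = 4 * m div n"
      define s where "s = n div (4 * (2 * (k * D) + 1))"
      have M: "0 < M" using \<epsilon> n L m0 by (simp add: M_def)
      \<comment> \<open>Rounding: n/32 - 1 \<ge> n/33 as soon as n \<ge> 1056 = 32 * 33.\<close>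
      have "n < 32 * (q + 1)" unfolding q_def by presburger
      then have "real n < real (32 * (q + 1))" by (simp only: of_nat_less_iff)
      then have "real n < 32 * (real q + 1)" by simp
      then have q: "real n / 33 \<le> real q" "0 < real q" "32 * q \<le> n"
        using n by (simp_all add: q_def)
      have p: "M / real q \<le> real p" "real p < M / real q + 1"
        using M q by (simp_all add: p_def) linarith+
      have k: "real k \<le> \<epsilon> * L" "\<epsilon> * L < real k + 1"
        using \<epsilon> L by (simp_all add: k_def)
      have D: "real D \<le> 4 * (real m / real n)"
        using of_nat_div_le_of_nat[of "4 * m" n, where ?'a = real] by (simp add: D_def)
      then have D': "real D \<le> 4 * real n powr (1 / 2 - \<epsilon>)" using mn by linarith
      have Mq: "M / real q \<le> 33 / 4096 * Y"
      proof -
        have "M / real q \<le> M / (real n / 33)"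
          using M q n by (intro divide_left_mono) auto
        also have "\<dots> = 33 / 4096 * Y"
          using n m0 by (simp add: M_def Y_def field_simps power3_eq_cube power2_eq_square)
        finally show ?thesis .
      qed
      have p16: "16 * p \<le> n"
      proof -
        \<comment> \<open>Here the lower bound m > n ln n enters: it keeps \<open>p\<close> below a
          small multiple of \<open>n\<close>.\<close>
        have "Y \<le> \<epsilon> * real n"
          using mult_left_mono[of "real n * L" "real m" "\<epsilon> * real n"] \<epsilon> n nL m0
          by (simp add: Y_def field_simps power2_eq_square)
        also have "\<dots> \<le> real n / 2" using \<epsilon> n by simp
        finally have "real p \<le> 33 / 8192 * real n + 1" using Mq p(2) by linarith
        then show ?thesis using n by linarith
      qed
      have pD: "16 * (p * D) \<le> n * (k + 1)"
      proof -
        have "real p * real D \<le> (33 / 4096 * Y + 1) * (4 * (real m / real n))"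
        proof (intro mult_mono)
          show "real p \<le> 33 / 4096 * Y + 1" using p(2) Mq by linarith
          show "0 \<le> 33 / 4096 * Y + 1" using \<epsilon> L by (simp add: Y_def)
        qed (use D in simp_all)
        also have "\<dots> = 33 / 1024 * (\<epsilon> * L * real n) + 4 * (real m / real n)"
          using n m0 by (simp add: Y_def field_simps power2_eq_square)
        finally have "16 * (real p * real D) \<le> 33 / 64 * (\<epsilon> * L * real n) + 64 * real n powr (1 / 2 - \<epsilon>)"
          using mn by linarith
        also have "\<dots> \<le> real n * (\<epsilon> * L)"
          using elim(1) by (simp add: L_def algebra_simps)
        also have "\<dots> \<le> real n * (real k + 1)" using k n by (intro mult_left_mono) auto
        finally have "real (16 * (p * D)) \<le> real (n * (k + 1))" by (simp add: algebra_simps)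
        then show ?thesis by (simp only: of_nat_le_iff)
      qed
      have Dk: "D * k \<le> 2 * p"
      proof -
        have "real D * real k \<le> (4 * real n powr (1 / 2 - \<epsilon>)) * (\<epsilon> * L)"
          using D' k \<epsilon> L by (intro mult_mono) auto
        also have "\<dots> \<le> real n powr (1 / 2 + \<epsilon>) / 64 * (\<epsilon> * L)"
          using elim(2) \<epsilon> L by (intro mult_right_mono) auto
        also have "real n powr (1 / 2 + \<epsilon>) \<le> real n ^ 2 / real m"
        proof -
          have "real m * real n powr (1 / 2 + \<epsilon>) \<le> real n powr (3 / 2 - \<epsilon>) * real n powr (1 / 2 + \<epsilon>)"
            using m(2) by (intro mult_right_mono) auto
          also have "\<dots> = real n ^ 2" using n by (simp flip: powr_add)
          finally show ?thesis using m0 by (simp add: field_simps)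
        qed
        \<comment> \<open>The constants match exactly, since 2 * 32 / 2^12 = 1/64.\<close>
        also have "real n ^ 2 / real m / 64 * (\<epsilon> * L) = 2 * (M / (real n / 32))"
          using n m0 by (simp add: M_def Y_def field_simps power3_eq_cube power2_eq_square)
        also have "\<dots> \<le> 2 * (M / real q)"
          using M q by (intro mult_left_mono divide_left_mono) auto
        also have "\<dots> \<le> 2 * real p" using p by simp
        finally have "real (D * k) \<le> real (2 * p)"
          using \<epsilon> L by (simp add: divide_right_mono mult_right_mono)
        then show ?thesis by (simp only: of_nat_le_iff)
      qed
      have two_k: "2 ^ k \<le> real n powr \<epsilon>"
      proof -
        have "(2::real) ^ k \<le> exp 1 ^ k"
          using exp_ge_add_one_self[of "1::real"] by (intro power_mono) auto
        also have "\<dots> = exp (real k)" by (simp flip: exp_of_nat_mult)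
        also have "\<dots> \<le> exp (\<epsilon> * L)" using k by simp
        also have "\<dots> = real n powr \<epsilon>" using n by (simp add: powr_def L_def)
        finally show ?thesis .
      qed
      have neg_powr: "real n powr - \<epsilon> \<le> 1 / 2 ^ k"
        using two_k n by (simp add: powr_minus divide_simps)
      have Ss: "S n \<le> real s"
      proof -
        have "real k * real D \<le> (\<epsilon> * L) * (4 * real n powr (1 / 2 - \<epsilon>))"
          using D' k \<epsilon> L by (intro mult_mono) auto
        then have le: "real (4 * (2 * (k * D) + 1)) \<le> 32 * (\<epsilon> * L) * real n powr (1 / 2 - \<epsilon>) + 4"
          by (simp add: algebra_simps)
        have pos: "0 < real (4 * (2 * (k * D) + 1))" by (simp only: of_nat_0_less_iff) simp
        have "real n / (32 * (\<epsilon> * L) * real n powr (1 / 2 - \<epsilon>) + 4) \<le> real n / real (4 * (2 * (k * D) + 1))"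
          by (rule divide_left_mono[OF le _ mult_pos_pos[OF less_le_trans[OF pos le] pos]]) simp
        also have "\<dots> \<le> real s + 1"
        proof -
          have "n < 4 * (2 * (k * D) + 1) * (s + 1)"
            using dividend_less_times_div[of "4 * (2 * (k * D) + 1)" n] by (simp add: s_def)
          then have "real n < real (4 * (2 * (k * D) + 1) * (s + 1))" by (simp only: of_nat_less_iff)
          also have "\<dots> = (real s + 1) * real (4 * (2 * (k * D) + 1))"
            by (simp only: of_nat_mult of_nat_add of_nat_1 mult.commute)
          finally show ?thesis unfolding pos_divide_le_eq[OF pos] by (rule less_imp_le)
        qed
        finally show ?thesis by (simp add: S_def L_def)
      qed
      have s0: "0 < s" using Ss elim(3) by simp
      have s4: "4 * (s * (2 * (k * D) + 1)) \<le> n"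
        unfolding s_def by (subst mult.left_commute) (rule div_times_less_eq_dividend)
      have small1: "real q * real n * exp (- (real s / 2 ^ k / 16)) < 1"
      proof -
        \<comment> \<open>The exponent exceeds 2 ln n, so the exponential beats the factor q n \<le>
          n^2.\<close>
        have "S n * real n powr - \<epsilon> \<le> real s * (1 / 2 ^ k)"
          by (rule mult_mono[OF Ss neg_powr]) simp_all
        then have "2 * L < real s / 2 ^ k / 16" using elim(4) by (simp add: L_def)
        then have "exp (- (real s / 2 ^ k / 16)) < exp (- (2 * L))" by simp
        also have "\<dots> = 1 / real n ^ 2"
          unfolding exp_minus exp_double using n by (simp add: L_def divide_inverse)
        finally have "real n ^ 2 * exp (- (real s / 2 ^ k / 16)) < 1"
          using n by (simp add: field_simps)
        moreover have "real q * real n * exp (- (real s / 2 ^ k / 16)) \<le> real n ^ 2 * exp (- (real s / 2 ^ k / 16))"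
          unfolding power2_eq_square using q(3) by (intro mult_right_mono) simp_all
        ultimately show ?thesis by linarith
      qed
      have small2: "(2 * (real p + 1)) ^ k * exp (- real q / 2 ^ k) < 1"
      proof -
        have "real (16 * p) \<le> real n" using p16 by (simp only: of_nat_le_iff)
        then have "2 * (real p + 1) \<le> real n" using n(1) by simp
        then have "(2 * (real p + 1)) ^ k \<le> real n ^ k" by (intro power_mono) auto
        also have "\<dots> = exp (real k * L)" using n by (simp add: L_def exp_of_nat_mult)
        also have "\<dots> \<le> exp (\<epsilon> * L * L)" using k L by (simp add: mult_right_mono)
        finally have "(2 * (real p + 1)) ^ k * exp (- real q / 2 ^ k) \<le> exp (\<epsilon> * L * L) * exp (- real q / 2 ^ k)"
          by (intro mult_right_mono) auto
        also have "\<dots> = exp (\<epsilon> * L * L - real q / 2 ^ k)" by (simp flip: exp_add)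
        also have "\<dots> < 1"
        proof -
          have "real n / 33 * real n powr - \<epsilon> \<le> real q * (1 / 2 ^ k)"
            by (rule mult_mono[OF q(1) neg_powr]) simp_all
          with elim(5) have "\<epsilon> * L * L < real q * (1 / 2 ^ k)"
            unfolding L_def by (rule less_le_trans)
          then show ?thesis by simp
        qed
        finally show ?thesis .
      qed
      have mD: "4 * m < n * (D + 1)"
        unfolding D_def using n dividend_less_times_div[of n "4 * m"] by simp
      have "M \<le> real (p * q)" using p(1) q by (simp add: field_simps)
      then show "\<exists>p q k D s :: nat.
        \<epsilon> * real n ^ 3 * ln (real n) / (2 ^ 12 * real m) \<le> real (p * q) \<and>
        (2 * (real p + 1)) ^ k * exp (- real q / 2 ^ k) < 1 \<and>
        4 * m < n * (D + 1) \<and>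
        16 * p \<le> n \<and> 16 * (p * D) \<le> n * (k + 1) \<and> D * k \<le> 2 * p \<and> 32 * q \<le> n \<and>
        0 < s \<and> 4 * (s * (2 * (k * D) + 1)) \<le> n \<and>
        real q * real n * exp (- (real s / 2 ^ k / 16)) < 1"
        using small1 small2 mD p16 pD Dk q(3) s0 s4 unfolding M_def L_def by blast
    qed
  qed
qed

theorem theorem3p4:
  fixes \<epsilon> :: real
  assumes "\<epsilon> > 0"
  shows "\<exists>n0 :: nat. \<forall>n \<ge> n0. \<forall>m :: nat.
           real n * ln (real n) < real m \<and> real m < real n powr (3/2 - \<epsilon>) \<longrightarrow>
           (\<exists>(V :: nat set) E. simple_graph V E \<and> card V = n \<and> universal n m V E \<and>
              real (card E) \<le> real (n choose 2) - \<epsilon> * real n ^ 3 * ln (real n) / (2 ^ 12 * real m))"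
proof -
  let ?P = "\<lambda>n :: nat. \<forall>m :: nat.
           real n * ln (real n) < real m \<and> real m < real n powr (3/2 - \<epsilon>) \<longrightarrow>
           (\<exists>(V :: nat set) E. simple_graph V E \<and> card V = n \<and> universal n m V E \<and>
              real (card E) \<le> real (n choose 2) - \<epsilon> * real n ^ 3 * ln (real n) / (2 ^ 12 * real m))"
  have "\<forall>\<^sub>F n in sequentially. ?P n"
  proof (cases "\<epsilon> < 1 / 2")
    \<comment> \<open>For \<epsilon> \<ge> 1/2 no \<open>m\<close> qualifies once ln n \<ge> 1,
      because n^(3/2 - \<epsilon>) \<le> n.\<close>
    case False
    have "\<forall>\<^sub>F n :: nat in sequentially. 1 \<le> ln (real n)" by real_asymp
    with eventually_ge_at_top[of "1 :: nat"] show ?thesis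
    proof eventually_elim
      case (elim n)
      have "real n powr (3 / 2 - \<epsilon>) \<le> real n powr 1"
        using False elim(1) by (intro powr_mono) auto
      also have "\<dots> \<le> real n * ln (real n)"
        using elim mult_left_mono[OF elim(2), of "real n"] by simp
      finally show ?case by auto
    qed
  next
    case True
    from ex_parameters[OF assms this] show ?thesis
    proof eventually_elim
      case (elim n)
      show ?case
      proof (intro allI impI, elim conjE)
        fix m :: nat
        assume "real n * ln (real n) < real m" "real m < real n powr (3 / 2 - \<epsilon>)"
        with elim obtain p q k D s :: nat where
          pq: "\<epsilon> * real n ^ 3 * ln (real n) / (2 ^ 12 * real m) \<le> real (p * q)"
          and small: "(2 * (real p + 1)) ^ k * exp (- real q / 2 ^ k) < 1"
          and pars: "4 * m < n * (D + 1)" "16 * p \<le> n" "16 * (p * D) \<le> n * (k + 1)"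
            "D * k \<le> 2 * p" "32 * q \<le> n" "0 < s" "4 * (s * (2 * (k * D) + 1)) \<le> n"
            "real q * real n * exp (- (real s / 2 ^ k / 16)) < 1"
          by blast
        have small': "(2 * (real (card {..<p}) + 1)) ^ k * exp (- real (card {..<q}) / 2 ^ k) < 1"
          using small by (simp only: card_lessThan)
        \<comment> \<open>The host is fixed here, from \<open>n\<close> and \<open>m\<close> alone;
          a single \<open>\<tau>\<close> serves all graphs \<open>F\<close>.\<close>
        obtain \<tau> where "\<forall>Q R. Q \<subseteq> {..<p} \<longrightarrow> card Q \<le> k \<longrightarrow> R \<subseteq> Q \<longrightarrow>
            2 ^ card Q * real (card {b \<in> {..<q}. \<tau> b \<inter> Q = R}) \<le> 4 * real q"
          using ex_balanced_family[OF finite_lessThan finite_lessThan small'] unfolding card_lessThan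
          by (elim exE)
        note \<tau> = this[rule_format]
        let ?K = "{e. e \<subseteq> {..<n} \<and> card e = 2}"
        let ?E = "?K - missing p q \<tau>"
        have sub: "missing p q \<tau> \<subseteq> ?K" using pars by (intro missing_subset) linarith
        have "simple_graph {..<n} ?E" by (auto simp: simple_graph_def)
        moreover have "universal n m {..<n} ?E"
          using universal_complement_missing[OF \<tau> pars] by blast
        moreover have "real (card ?E) = real (n choose 2) - real (p * q)"
        proof -
          have fin: "finite ?K" by (rule finite_subset[of _ "Pow {..<n}"]) auto
          have "card ?K = n choose 2" using n_subsets[of "{..<n}" 2] by simp
          then have "card ?E = (n choose 2) - p * q"
            using sub fin by (simp add: card_Diff_subset finite_subset card_missing)
          moreover have "p * q \<le> n choose 2"
            using card_mono[OF fin sub] \<open>card ?K = _\<close> by (simp add: card_missing)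
          ultimately show ?thesis by (simp add: of_nat_diff)
        qed
        ultimately show "\<exists>(V :: nat set) E. simple_graph V E \<and> card V = n \<and> universal n m V E \<and>
            real (card E) \<le> real (n choose 2) - \<epsilon> * real n ^ 3 * ln (real n) / (2 ^ 12 * real m)"
          using pq by (intro exI[of _ "{..<n}"] exI[of _ ?E]) auto
      qed
    qed
  qed
  then show ?thesis unfolding eventually_sequentially .
qed

end
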